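(* Let $0<\varepsilon<1$ and suppose $A\in\mathbb{R}^{n\times d}$ has full column rank. If the entries of $S\in\mathbb{R}^{m\times n}$ are i.i.d. $N(0,1/m)$ with $m=O(d/\varepsilon^2)$ (with a sufficiently large hidden constant), then for any (fixed) vectors $a\in\mathbb{R}^d$, $b\in\mathbb{R}^n$ and $x^*=A^\dagger b$, with probability $1-1/\mathrm{poly}(d)$ over $S$, $$\left|a^\top(SA)^\dagger Sb-a^\top x^*\right|\lesssim\frac{\varepsilon\sqrt{\log d}}{\sqrt d}\,\|a\|_2\,\|b-Ax^*\|_2\,\|A^\dagger\|_2 .$$
   Context: $M^\dagger$ is the Moore–Penrose pseudoinverse; $\|\cdot\|_2$ is the Euclidean norm for vectors and the spectral norm for matrices. $f\lesssim g$ means $f\le Cg$ for a constant $C$. "With probability $1-1/\mathrm{poly}(d)$" means: for every constant $c>0$, with probability at least $1-d^{-c}$ for all sufficiently large $d$, where the hidden constants may depend on $c$. *)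

theory Defs
  imports "HOL-Probability.Probability" "Jordan_Normal_Form.DL_Rank"
begin

unbundle no inner_syntax
unbundle no vec_syntax

definition euclid_norm :: "real vec \<Rightarrow> real" where
  "euclid_norm v = sqrt (v \<bullet> v)"

definition spectral_norm :: "real mat \<Rightarrow> real" where
  "spectral_norm M =
     (SUP v \<in> {v \<in> carrier_vec (dim_col M). euclid_norm v \<le> 1}. euclid_norm (M *\<^sub>v v))"

text \<open>The Penrose conditions, with the transpose as the adjoint because the entries are real. They
  determine at most one \<open>X\<close>, and every real matrix has one, so the description in \<open>pinv\<close> is proper.\<close>

definition is_pinv :: "real mat \<Rightarrow> real mat \<Rightarrow> bool" where
  "is_pinv M X \<longleftrightarrow>
     X \<in> carrier_mat (dim_col M) (dim_row M) \<and>
     M * X * M = M \<and>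
     X * M * X = X \<and>
     (M * X)\<^sup>T = M * X \<and>
     (X * M)\<^sup>T = X * M"

definition pinv :: "real mat \<Rightarrow> real mat" where
  "pinv M = (THE X. is_pinv M X)"

lemma is_pinv_unique:
  assumes "is_pinv M X" and "is_pinv M Y"
  shows "X = Y"
proof -
  define r c where "r = dim_row M" and "c = dim_col M"
  have M: "M \<in> carrier_mat r c" unfolding r_def c_def by auto
  have X: "X \<in> carrier_mat c r" "M * X * M = M" "X * M * X = X" "(M * X)\<^sup>T = M * X" "(X * M)\<^sup>T = X * M"
    using assms(1) by (auto simp: is_pinv_def r_def c_def)
  have Y: "Y \<in> carrier_mat c r" "M * Y * M = M" "Y * M * Y = Y" "(M * Y)\<^sup>T = M * Y" "(Y * M)\<^sup>T = Y * M"
    using assms(2) by (auto simp: is_pinv_def r_def c_def)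
  have MX: "M * X \<in> carrier_mat r r" and MY: "M * Y \<in> carrier_mat r r"
    and XM: "X * M \<in> carrier_mat c c" and YM: "Y * M \<in> carrier_mat c c"
    using M X(1) Y(1) by auto
  have "M * X = (M * Y) * (M * X)"
    using Y(2) assoc_mult_mat[OF MY M X(1)] by simp
  moreover have "((M * X) * (M * Y))\<^sup>T = (M * Y) * (M * X)"
    using transpose_mult[OF MX MY] X(4) Y(4) by simp
  moreover have "(M * X) * (M * Y) = M * Y"
    using X(2) assoc_mult_mat[OF MX M Y(1)] by simp
  ultimately have 1: "M * X = M * Y"
    using Y(4) by simp
  have "X * M = (X * M) * (Y * M)"
    using Y(2) assoc_mult_mat[OF X(1) M YM] assoc_mult_mat[OF M Y(1) M] by simp
  moreover have "((X * M) * (Y * M))\<^sup>T = (Y * M) * (X * M)"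
    using transpose_mult[OF XM YM] X(5) Y(5) by simp
  moreover have "(Y * M) * (X * M) = Y * M"
    using X(2) assoc_mult_mat[OF Y(1) M XM] assoc_mult_mat[OF M X(1) M] by simp
  ultimately have 2: "X * M = Y * M"
    using X(5) by simp
  have "X = Y * M * X"
    using X(3) 2 by simp
  also have "\<dots> = Y * (M * Y)"
    using assoc_mult_mat[OF Y(1) M X(1)] 1 by simp
  also have "\<dots> = Y"
    using assoc_mult_mat[OF Y(1) M Y(1)] Y(3) by simp
  finally show ?thesis .
qed

lemma pinv_eqI: "is_pinv M X \<Longrightarrow> pinv M = X"
  unfolding pinv_def using is_pinv_unique by blast

text \<open>
  \<open>S\<close> is an \<open>m \<times> n\<close> random matrix on the probability space \<open>M\<close> with i.i.d. entries of
  law \<open>N(0, 1/m)\<close>; the second parameter of \<^const>\<open>normal_density\<close> is the standard deviation.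
\<close>

definition gaussian_sketch :: "'w measure \<Rightarrow> nat \<Rightarrow> nat \<Rightarrow> ('w \<Rightarrow> real mat) \<Rightarrow> bool" where
  "gaussian_sketch M m n S \<longleftrightarrow>
     prob_space M \<and>
     (\<forall>\<omega> \<in> space M. S \<omega> \<in> carrier_mat m n) \<and>
     prob_space.indep_vars M (\<lambda>_. borel) (\<lambda>(i, j) \<omega>. S \<omega> $$ (i, j)) ({..<m} \<times> {..<n}) \<and>
     (\<forall>i<m. \<forall>j<n. distributed M lborel (\<lambda>\<omega>. S \<omega> $$ (i, j)) (normal_density 0 (sqrt (1 / real m))))"

end

theory Submission
  imports Defs "HOL-Real_Asymp.Real_Asymp"
begin

text \<open>
  Write \<open>G = S * A\<close>, \<open>r = b - A * xs\<close> and \<open>w = (pinv G)\<^sup>T * a\<close>. If \<open>G\<close> is injective, then \<open>pinv G * G\<close>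
  is the identity and the error equals \<open>w \<bullet> S r\<close>. Here \<open>w\<close> depends on \<open>S * A\<close> only, and \<open>r\<close> is
  orthogonal to the range of \<open>A\<close>, so given \<open>w\<close> the error is Gaussian with variance \<open>|w|\<^sup>2 |r|\<^sup>2 / m\<close>.
  Instead of conditioning, the proof shifts the Gaussian matrix by outer products with \<open>r\<close>
  (Cameron--Martin), which leaves \<open>w\<close> unchanged and bounds the exponential moment for countably
  many values of \<open>w\<close>; rounding \<open>w\<close> and Fatou's lemma give the general case. Finally
  \<open>|w| \<le> 5 |a| |pinv A|\<close> as soon as \<open>|A z| \<le> 5 |S A z|\<close> for all \<open>z\<close>, which holds with probability
  exponentially close to 1 by a union bound over lattice points in coordinates of the range of \<open>A\<close>.
  The event in question is measurable because the pseudoinverse is the pointwise limit of its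
  Tikhonov regularisations, whose entries are rational functions of the matrix entries.
\<close>

subsection \<open>Shifts of Gaussian matrices\<close>

text \<open>The obstacle is that \<open>w\<close> is a function of the same random matrix as
  \<open>S r\<close>. A Cameron--Martin shift by the outer product of \<open>\<mu>\<close> and
  \<open>r\<close> is available for a fixed \<open>\<mu>\<close>, whereas the exponential moment
  calls for \<open>\<mu> = w\<close>. On a set where the rounded weight is constant the correct
  shift is a fixed one, and the set itself is invariant under it. Each such set therefore
  contributes exactly its own probability, and the contributions add up to 1. No regular conditional
  law of \<open>S r\<close> given \<open>S A\<close> has to be formulated.

  The two roles of \<open>m\<close> are separate. The accuracy comes from the variance
  \<open>1 / m\<close> alone: a deviation of \<open>sqrt (t / m)\<close> with \<open>t\<close> of
  order \<open>ln d\<close> gives the stated rate when \<open>m\<close> is of order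
  \<open>d / \<epsilon>^2\<close>. The embedding only has to control \<open>|w|\<close>, so a
  constant distortion is enough. A lattice of mesh of order \<open>1 / sqrt d\<close> then suffices,
  and its exponentially many points in \<open>d\<close> are outweighed by
  \<open>exp (- m / 4)\<close> as soon as \<open>m\<close> is at least \<open>400 d\<close>.\<close>

definition gauss_measure :: "real \<Rightarrow> real \<Rightarrow> real measure" where
  "gauss_measure \<mu> \<sigma> = density lborel (normal_density \<mu> \<sigma>)"

lemma sets_gauss_measure [simp, measurable_cong]: "sets (gauss_measure \<mu> \<sigma>) = sets borel"
  by (simp add: gauss_measure_def)

lemma space_gauss_measure [simp]: "space (gauss_measure \<mu> \<sigma>) = UNIV"
  by (simp add: gauss_measure_def)

lemma prob_space_gauss_measure: "\<sigma> > 0 \<Longrightarrow> prob_space (gauss_measure \<mu> \<sigma>)"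
  unfolding gauss_measure_def by (rule prob_space_normal_density)

lemma sets_PiM_gauss [simp]: "sets (PiM I (\<lambda>i. gauss_measure (h i) \<sigma>)) = sets (PiM I (\<lambda>_. borel))"
  by (intro sets_PiM_cong) auto

text \<open>Expanding \<open>(x - h)^2\<close> cancels the term quadratic in \<open>x\<close>, so
  the likelihood ratio of the shifted law is the exponential of an affine function.\<close>

lemma gauss_measure_shift_density:
  assumes "\<sigma> > 0"
  shows "gauss_measure h \<sigma> = density (gauss_measure 0 \<sigma>) (\<lambda>x. ennreal (exp (h * x / \<sigma>\<^sup>2 - h\<^sup>2 / (2 * \<sigma>\<^sup>2))))"
proof -
  have "normal_density h \<sigma> x = normal_density 0 \<sigma> x * exp (h * x / \<sigma>\<^sup>2 - h\<^sup>2 / (2 * \<sigma>\<^sup>2))" for x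
  proof -
    have "- (x - h)\<^sup>2 / (2 * \<sigma>\<^sup>2) = - (x - 0)\<^sup>2 / (2 * \<sigma>\<^sup>2) + (h * x / \<sigma>\<^sup>2 - h\<^sup>2 / (2 * \<sigma>\<^sup>2))"
      using assms by (simp add: field_simps power2_eq_square)
    then show ?thesis by (simp add: normal_density_def exp_add mult.assoc flip: exp_add)
  qed
  then show ?thesis
    unfolding gauss_measure_def
    by (subst density_density_eq) (auto simp: ennreal_mult' intro!: density_cong)
qed

lemma distr_gauss_measure_shift:
  assumes "\<sigma> > 0"
  shows "distr (gauss_measure 0 \<sigma>) borel (\<lambda>x. x + h) = gauss_measure h \<sigma>"
proof -
  interpret prob_space "gauss_measure 0 \<sigma>" using assms by (rule prob_space_gauss_measure)
  have "distributed (gauss_measure 0 \<sigma>) lborel (\<lambda>x. x) (normal_density 0 \<sigma>)"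
    unfolding distributed_def gauss_measure_def
    by (auto intro!: distr_id2)
  from normal_density_affine[OF this assms, of 1 h]
  have "distributed (gauss_measure 0 \<sigma>) lborel (\<lambda>x. h + x) (normal_density h \<sigma>)" by simp
  then have "distr (gauss_measure 0 \<sigma>) lborel (\<lambda>x. x + h) = gauss_measure h \<sigma>"
    by (auto simp: distributed_def gauss_measure_def add.commute)
  moreover have "distr (gauss_measure 0 \<sigma>) lborel (\<lambda>x. x + h) = distr (gauss_measure 0 \<sigma>) borel (\<lambda>x. x + h)"
    by (rule distr_cong) auto
  ultimately show ?thesis by simp
qed

text \<open>A product measure is determined by its values on boxes. On a box both the density and
  the indicator are products over the coordinates, so the integral splits into one-dimensional
  ones.\<close>

lemma PiM_gauss_shift_density:
  assumes "finite I" "\<sigma> > 0"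
  shows "density (PiM I (\<lambda>_. gauss_measure 0 \<sigma>)) (\<lambda>x. \<Prod>i\<in>I. ennreal (exp (h i * x i / \<sigma>\<^sup>2 - (h i)\<^sup>2 / (2 * \<sigma>\<^sup>2))))
     = PiM I (\<lambda>i. gauss_measure (h i) \<sigma>)" (is "density ?Q ?f = _")
proof -
  interpret product_prob_space "\<lambda>i. gauss_measure (h i) \<sigma>" I
    by (simp add: product_prob_spaceI prob_space_gauss_measure assms)
  interpret Z: product_prob_space "\<lambda>i. gauss_measure 0 \<sigma>" I
    by (simp add: product_prob_spaceI prob_space_gauss_measure assms)
  show ?thesis
  proof (rule PiM_eqI)
    show "finite I" by fact
    show "sets (density ?Q ?f) = sets (PiM I (\<lambda>i. gauss_measure (h i) \<sigma>))" by simp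
    fix A assume A: "\<And>i. i \<in> I \<Longrightarrow> A i \<in> sets (gauss_measure (h i) \<sigma>)"
    have [measurable]: "Pi\<^sub>E I A \<in> sets ?Q"
      using A assms(1) by (intro sets_PiM_I_finite) auto
    have "emeasure (density ?Q ?f) (Pi\<^sub>E I A) = (\<integral>\<^sup>+x. ?f x * indicator (Pi\<^sub>E I A) x \<partial>?Q)"
      by (rule emeasure_density) measurable
    also have "\<dots> = (\<integral>\<^sup>+x. (\<Prod>i\<in>I. ennreal (exp (h i * x i / \<sigma>\<^sup>2 - (h i)\<^sup>2 / (2 * \<sigma>\<^sup>2))) * indicator (A i) (x i)) \<partial>?Q)"
    proof (rule nn_integral_cong)
      fix x assume x: "x \<in> space ?Q"
      have "indicator (Pi\<^sub>E I A) x = (\<Prod>i\<in>I. indicator (A i) (x i) :: ennreal)"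
      proof (cases "x \<in> Pi\<^sub>E I A")
        case True then show ?thesis by (auto simp: PiE_iff)
      next
        case False
        then obtain i where "i \<in> I" "x i \<notin> A i" using x by (auto simp: space_PiM PiE_iff)
        then have "(\<Prod>i\<in>I. indicator (A i) (x i) :: ennreal) = 0"
          using assms(1) by (intro prod_zero) (auto intro!: bexI[of _ i])
        with False show ?thesis by simp
      qed
      then show "?f x * indicator (Pi\<^sub>E I A) x = (\<Prod>i\<in>I. ennreal (exp (h i * x i / \<sigma>\<^sup>2 - (h i)\<^sup>2 / (2 * \<sigma>\<^sup>2))) * indicator (A i) (x i))"
        by (simp add: prod.distrib)
    qed
    also have "\<dots> = (\<Prod>i\<in>I. \<integral>\<^sup>+x. ennreal (exp (h i * x / \<sigma>\<^sup>2 - (h i)\<^sup>2 / (2 * \<sigma>\<^sup>2))) * indicator (A i) x \<partial>gauss_measure 0 \<sigma>)"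
      using A assms(1) by (intro Z.product_nn_integral_prod) auto
    also have "\<dots> = (\<Prod>i\<in>I. emeasure (gauss_measure (h i) \<sigma>) (A i))"
      using A assms(2) by (intro prod.cong refl) (simp add: gauss_measure_shift_density[of \<sigma> "h _"] emeasure_density)
    finally show "emeasure (density ?Q ?f) (Pi\<^sub>E I A) = (\<Prod>i\<in>I. emeasure (gauss_measure (h i) \<sigma>) (A i))" .
  qed
qed

lemma distr_PiM_gauss_shift:
  assumes "finite I" "\<sigma> > 0"
  shows "distr (PiM I (\<lambda>_. gauss_measure 0 \<sigma>)) (PiM I (\<lambda>_. borel)) (\<lambda>x. \<lambda>i\<in>I. x i + h i)
     = PiM I (\<lambda>i. gauss_measure (h i) \<sigma>)" (is "distr ?Q _ ?f = _")
proof -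
  interpret product_prob_space "\<lambda>i. gauss_measure (h i) \<sigma>" I
    by (simp add: product_prob_spaceI prob_space_gauss_measure assms)
  interpret Z: product_prob_space "\<lambda>i. gauss_measure 0 \<sigma>" I
    by (simp add: product_prob_spaceI prob_space_gauss_measure assms)
  have [measurable]: "?f \<in> measurable ?Q (PiM I (\<lambda>_. borel))"
    by measurable
  show ?thesis
  proof (rule PiM_eqI)
    show "finite I" by fact
    show "sets (distr ?Q (PiM I (\<lambda>_. borel)) ?f) = sets (PiM I (\<lambda>i. gauss_measure (h i) \<sigma>))" by simp
    fix A assume A: "\<And>i. i \<in> I \<Longrightarrow> A i \<in> sets (gauss_measure (h i) \<sigma>)"
    have P: "Pi\<^sub>E I A \<in> sets (PiM I (\<lambda>_. borel))"
      using A assms(1) by (intro sets_PiM_I_finite) auto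
    have "emeasure (distr ?Q (PiM I (\<lambda>_. borel)) ?f) (Pi\<^sub>E I A) = emeasure ?Q (?f -` Pi\<^sub>E I A \<inter> space ?Q)"
      by (rule emeasure_distr) (use P in measurable)
    also have "?f -` Pi\<^sub>E I A \<inter> space ?Q = (\<Pi>\<^sub>E i\<in>I. (\<lambda>x. x + h i) -` A i)"
      by (auto simp: space_PiM PiE_iff extensional_def)
    also have "emeasure ?Q \<dots> = (\<Prod>i\<in>I. emeasure (gauss_measure 0 \<sigma>) ((\<lambda>x. x + h i) -` A i))"
    proof (rule Z.emeasure_PiM)
      fix i assume "i \<in> I"
      then show "(\<lambda>x. x + h i) -` A i \<in> sets (gauss_measure 0 \<sigma>)"
        using A[of i] measurable_sets[of "\<lambda>x. x + h i" borel borel "A i"] by simp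
    qed fact
    also have "\<dots> = (\<Prod>i\<in>I. emeasure (gauss_measure (h i) \<sigma>) (A i))"
      using A assms(2) by (intro prod.cong refl) (simp add: distr_gauss_measure_shift[of \<sigma> "h _", symmetric] emeasure_distr)
    finally show "emeasure (distr ?Q (PiM I (\<lambda>_. borel)) ?f) (Pi\<^sub>E I A) = (\<Prod>i\<in>I. emeasure (gauss_measure (h i) \<sigma>) (A i))" .
  qed
qed

text \<open>Both sides are the integral of \<open>f\<close> against the product law with means
  \<open>h\<close>: the left one obtains that law from a density, the right one as the image under
  translation.\<close>

lemma cameron_martin:
  assumes "finite I" "\<sigma> > 0" and [measurable]: "f \<in> borel_measurable (PiM I (\<lambda>_. borel))"
  shows "(\<integral>\<^sup>+x. f x * ennreal (exp (\<Sum>i\<in>I. h i * x i / \<sigma>\<^sup>2 - (h i)\<^sup>2 / (2 * \<sigma>\<^sup>2))) \<partial>PiM I (\<lambda>_. gauss_measure 0 \<sigma>))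
       = (\<integral>\<^sup>+x. f (\<lambda>i\<in>I. x i + h i) \<partial>PiM I (\<lambda>_. gauss_measure 0 \<sigma>))" (is "integral\<^sup>N ?Q _ = _")
proof -
  let ?R = "PiM I (\<lambda>i. gauss_measure (h i) \<sigma>)"
  let ?g = "\<lambda>x. \<Prod>i\<in>I. ennreal (exp (h i * x i / \<sigma>\<^sup>2 - (h i)\<^sup>2 / (2 * \<sigma>\<^sup>2)))"
  have "ennreal (exp (\<Sum>i\<in>I. h i * x i / \<sigma>\<^sup>2 - (h i)\<^sup>2 / (2 * \<sigma>\<^sup>2))) = ?g x" for x
    by (simp add: exp_sum assms(1) prod_ennreal)
  then have "(\<integral>\<^sup>+x. f x * ennreal (exp (\<Sum>i\<in>I. h i * x i / \<sigma>\<^sup>2 - (h i)\<^sup>2 / (2 * \<sigma>\<^sup>2))) \<partial>?Q)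
     = integral\<^sup>N (density ?Q ?g) f"
    by (subst nn_integral_density) (auto simp: mult.commute)
  also have "\<dots> = integral\<^sup>N ?R f"
    by (simp add: PiM_gauss_shift_density assms)
  also have "\<dots> = (\<integral>\<^sup>+x. f (\<lambda>i\<in>I. x i + h i) \<partial>?Q)"
    by (subst distr_PiM_gauss_shift[OF assms(1,2), symmetric], subst nn_integral_distr) auto
  finally show ?thesis .
qed

section \<open>Rank-one shifts of a Gaussian matrix\<close>

definition gauss_matrix :: "nat \<Rightarrow> nat \<Rightarrow> real \<Rightarrow> (nat \<times> nat \<Rightarrow> real) measure" where
  "gauss_matrix m n \<sigma> = PiM ({..<m} \<times> {..<n}) (\<lambda>_. gauss_measure 0 \<sigma>)"

lemma sets_gauss_matrix [simp, measurable_cong]: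
  "sets (gauss_matrix m n \<sigma>) = sets (PiM ({..<m} \<times> {..<n}) (\<lambda>_. borel))"
  by (simp add: gauss_matrix_def)

lemma prob_space_gauss_matrix: "\<sigma> > 0 \<Longrightarrow> prob_space (gauss_matrix m n \<sigma>)"
  unfolding gauss_matrix_def by (intro prob_space_PiM prob_space_gauss_measure)

text \<open>The shift has entries \<open>\<sigma>^2 * \<mu> i * r j\<close>; the factor
  \<open>\<sigma>^2\<close> cancels the one in the density, which leaves the inner product of
  \<open>\<mu>\<close> with \<open>S r\<close> minus half its variance. A function that ignores the
  shift does not notice the change of measure.\<close>

lemma gauss_tilt_invariant:
  fixes \<mu> r :: "nat \<Rightarrow> real"
  assumes "\<sigma> > 0" and [measurable]: "f \<in> borel_measurable (PiM ({..<m} \<times> {..<n}) (\<lambda>_. borel))"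
    and inv: "\<And>x. x \<in> space (gauss_matrix m n \<sigma>) \<Longrightarrow>
       f (\<lambda>p\<in>{..<m} \<times> {..<n}. x p + \<sigma>\<^sup>2 * \<mu> (fst p) * r (snd p)) = f x"
  shows "(\<integral>\<^sup>+x. f x * ennreal (exp ((\<Sum>i<m. \<mu> i * (\<Sum>j<n. x (i, j) * r j))
            - \<sigma>\<^sup>2 / 2 * (\<Sum>i<m. (\<mu> i)\<^sup>2) * (\<Sum>j<n. (r j)\<^sup>2))) \<partial>gauss_matrix m n \<sigma>)
       = (\<integral>\<^sup>+x. f x \<partial>gauss_matrix m n \<sigma>)"
proof -
  let ?h = "\<lambda>p. \<sigma>\<^sup>2 * \<mu> (fst p) * r (snd p)" and ?I = "{..<m} \<times> {..<n}"
  have "(\<Sum>p\<in>?I. ?h p * x p / \<sigma>\<^sup>2 - (?h p)\<^sup>2 / (2 * \<sigma>\<^sup>2))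
      = (\<Sum>i<m. \<mu> i * (\<Sum>j<n. x (i, j) * r j)) - \<sigma>\<^sup>2 / 2 * (\<Sum>i<m. (\<mu> i)\<^sup>2) * (\<Sum>j<n. (r j)\<^sup>2)" for x
  proof -
    have "(\<Sum>p\<in>?I. ?h p * x p / \<sigma>\<^sup>2 - (?h p)\<^sup>2 / (2 * \<sigma>\<^sup>2))
       = (\<Sum>i<m. \<Sum>j<n. \<mu> i * (x (i, j) * r j) - \<sigma>\<^sup>2 / 2 * ((\<mu> i)\<^sup>2 * (r j)\<^sup>2))"
      using assms(1)
      by (auto simp: sum.cartesian_product power2_eq_square field_simps intro!: sum.cong)
    also have "\<dots> = (\<Sum>i<m. \<Sum>j<n. \<mu> i * (x (i, j) * r j)) - (\<Sum>i<m. \<Sum>j<n. \<sigma>\<^sup>2 / 2 * ((\<mu> i)\<^sup>2 * (r j)\<^sup>2))"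
      by (simp only: sum_subtractf)
    also have "(\<Sum>i<m. \<Sum>j<n. \<sigma>\<^sup>2 / 2 * ((\<mu> i)\<^sup>2 * (r j)\<^sup>2)) = \<sigma>\<^sup>2 / 2 * (\<Sum>i<m. (\<mu> i)\<^sup>2) * (\<Sum>j<n. (r j)\<^sup>2)"
      by (simp only: sum_product mult.assoc flip: sum_distrib_left)
    also have "(\<Sum>i<m. \<Sum>j<n. \<mu> i * (x (i, j) * r j)) = (\<Sum>i<m. \<mu> i * (\<Sum>j<n. x (i, j) * r j))"
      by (simp only: sum_distrib_left)
    finally show ?thesis .
  qed
  then have "(\<integral>\<^sup>+x. f x * ennreal (exp ((\<Sum>i<m. \<mu> i * (\<Sum>j<n. x (i, j) * r j))
            - \<sigma>\<^sup>2 / 2 * (\<Sum>i<m. (\<mu> i)\<^sup>2) * (\<Sum>j<n. (r j)\<^sup>2))) \<partial>gauss_matrix m n \<sigma>)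
      = (\<integral>\<^sup>+x. f (\<lambda>p\<in>?I. x p + ?h p) \<partial>gauss_matrix m n \<sigma>)"
    unfolding gauss_matrix_def using cameron_martin[of ?I \<sigma> f ?h] assms(1) by simp
  also have "\<dots> = (\<integral>\<^sup>+x. f x \<partial>gauss_matrix m n \<sigma>)"
    by (intro nn_integral_cong inv)
  finally show ?thesis .
qed

text \<open>For a constant weight this is the normalised moment generating function of a Gaussian,
  and the integral is 1. A random weight is rounded to a countable grid, where equality still holds
  level by level. Only the passage to the limit turns the equality into an inequality.\<close>

lemma gauss_exponential_supermartingale:
  fixes w :: "(nat \<times> nat \<Rightarrow> real) \<Rightarrow> nat \<Rightarrow> real" and r :: "nat \<Rightarrow> real"
  assumes "\<sigma> > 0" and w: "\<And>i. i < m \<Longrightarrow> (\<lambda>x. w x i) \<in> borel_measurable (PiM ({..<m} \<times> {..<n}) (\<lambda>_. borel))"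
    and inv: "\<And>x \<mu> i. x \<in> space (gauss_matrix m n \<sigma>) \<Longrightarrow> i < m \<Longrightarrow>
       w (\<lambda>p\<in>{..<m} \<times> {..<n}. x p + \<mu> (fst p) * r (snd p)) i = w x i"
  shows "(\<integral>\<^sup>+x. ennreal (exp ((\<Sum>i<m. w x i * (\<Sum>j<n. x (i, j) * r j))
            - \<sigma>\<^sup>2 / 2 * (\<Sum>i<m. (w x i)\<^sup>2) * (\<Sum>j<n. (r j)\<^sup>2))) \<partial>gauss_matrix m n \<sigma>) \<le> 1"
proof -
  let ?Q = "gauss_matrix m n \<sigma>" and ?I = "{..<m} \<times> {..<n}"
  interpret prob_space ?Q using assms(1) by (rule prob_space_gauss_matrix)
  have floor_meas: "(\<lambda>z. real_of_int \<lfloor>real (Suc k) * z\<rfloor> / real (Suc k)) \<in> borel_measurable borel" for k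
    by measurable
  define \<phi> where "\<phi> \<mu> x = (\<Sum>i<m. \<mu> i * (\<Sum>j<n. x (i, j) * r j))
            - \<sigma>\<^sup>2 / 2 * (\<Sum>i<m. (\<mu> i)\<^sup>2) * (\<Sum>j<n. (r j)\<^sup>2)" for \<mu> and x :: "nat \<times> nat \<Rightarrow> real"
  \<comment> \<open>Rounding down to multiples of \<open>1 / (k + 1)\<close> leaves countably many
    values, and as a function of \<open>w\<close> the rounded weight inherits its
    invariance.\<close>
  define g where "g k x i = real_of_int \<lfloor>real (Suc k) * w x i\<rfloor> / real (Suc k)" for k x i
  have [measurable]: "(\<lambda>x. x (i, j)) \<in> borel_measurable ?Q" if "i \<in> {..<m}" "j \<in> {..<n}" for i j
    using that by (subst measurable_cong_sets[OF sets_gauss_matrix refl]) (auto intro!: measurable_component_singleton)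
  have w_meas [measurable]: "(\<lambda>x. w x i) \<in> borel_measurable ?Q" if "i \<in> {..<m}" for i
    using w that by (subst measurable_cong_sets[OF sets_gauss_matrix refl]) auto
  have [measurable]: "(\<lambda>x. g k x i) \<in> borel_measurable ?Q" if "i \<in> {..<m}" for k i
  proof -
    from measurable_compose[OF w_meas[OF that] floor_meas] show ?thesis by (simp add: g_def)
  qed
  have [measurable]: "(\<lambda>x. \<phi> \<mu> x) \<in> borel_measurable ?Q" for \<mu>
    unfolding \<phi>_def by measurable
  have [measurable]: "(\<lambda>x. \<phi> (g k x) x) \<in> borel_measurable ?Q" for k
    unfolding \<phi>_def by measurable
  have disc: "(\<integral>\<^sup>+x. ennreal (exp (\<phi> (g k x) x)) \<partial>?Q) = 1" for k
  proof -
    \<comment> \<open>\<open>J\<close> contains every possible rounded weight vector and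
      \<open>hit q\<close> is the indicator of the level set of \<open>q\<close>. Integrals over
      \<open>count_space J\<close> serve as countable sums, so that they can be exchanged with the
      expectation.\<close>
    define J where "J = (\<Pi>\<^sub>E i\<in>{..<m}. range (\<lambda>z::int. real_of_int z / real (Suc k)))"
    define hit where "hit q x = (if \<forall>i\<in>{..<m}. g k x i = q i then 1 else 0 :: ennreal)" for q x
    have J: "countable J" unfolding J_def by (intro countable_PiE) auto
    have [measurable]: "hit q \<in> borel_measurable ?Q" for q
      unfolding hit_def by measurable
    have sum_hit: "(\<integral>\<^sup>+q. hit q x * F q \<partial>count_space J) = F (restrict (g k x) {..<m})" for x and F :: "_ \<Rightarrow> ennreal"
    proof -
      let ?q = "restrict (g k x) {..<m}"
      have "?q \<in> J" by (auto simp: J_def g_def)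
      have "(\<integral>\<^sup>+q. hit q x * F q \<partial>count_space J) = (\<integral>\<^sup>+q. F ?q * indicator {?q} q \<partial>count_space J)"
      proof (rule nn_integral_cong)
        fix q assume "q \<in> space (count_space J)"
        then have "(\<forall>i\<in>{..<m}. g k x i = q i) \<longleftrightarrow> q = ?q"
          by (auto simp: J_def PiE_iff extensional_def fun_eq_iff)
        then show "hit q x * F q = F ?q * indicator {?q} q" by (auto simp: hit_def)
      qed
      also have "\<dots> = F ?q" using \<open>?q \<in> J\<close> by (simp add: nn_integral_cmult_indicator)
      finally show ?thesis .
    qed
    have \<phi>_restrict: "\<phi> (restrict \<mu> {..<m}) x = \<phi> \<mu> x" for \<mu> x
      by (simp add: \<phi>_def)
    have "(\<integral>\<^sup>+x. ennreal (exp (\<phi> (g k x) x)) \<partial>?Q)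
        = (\<integral>\<^sup>+x. \<integral>\<^sup>+q. hit q x * ennreal (exp (\<phi> q x)) \<partial>count_space J \<partial>?Q)"
      by (simp add: sum_hit \<phi>_restrict)
    also have "\<dots> = (\<integral>\<^sup>+q. \<integral>\<^sup>+x. hit q x * ennreal (exp (\<phi> q x)) \<partial>?Q \<partial>count_space J)"
      using J by (rule nn_integral_count_space_nn_integral) measurable
    also have "\<dots> = (\<integral>\<^sup>+q. \<integral>\<^sup>+x. hit q x \<partial>?Q \<partial>count_space J)"
    proof (rule nn_integral_cong)
      \<comment> \<open>Once \<open>q\<close> is fixed the direction of the shift is deterministic
        and \<open>hit q\<close> is invariant under it, so the exponential factor may be
        dropped.\<close>
      fix q
      show "(\<integral>\<^sup>+x. hit q x * ennreal (exp (\<phi> q x)) \<partial>?Q) = (\<integral>\<^sup>+x. hit q x \<partial>?Q)"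
        unfolding \<phi>_def
      proof (rule gauss_tilt_invariant[OF assms(1)])
        show "hit q \<in> borel_measurable (PiM ?I (\<lambda>_. borel))"
          by (subst measurable_cong_sets[OF sets_gauss_matrix[symmetric] refl]) measurable
        fix x assume "x \<in> space ?Q"
        then show "hit q (\<lambda>p\<in>?I. x p + \<sigma>\<^sup>2 * q (fst p) * r (snd p)) = hit q x"
          using inv[of x _ "\<lambda>i. \<sigma>\<^sup>2 * q i"] by (simp add: hit_def g_def)
      qed
    qed
    also have "\<dots> = (\<integral>\<^sup>+x. \<integral>\<^sup>+q. hit q x \<partial>count_space J \<partial>?Q)"
      using J by (rule nn_integral_count_space_nn_integral[symmetric]) measurable
    also have "\<dots> = 1"
      using sum_hit[of _ "\<lambda>_. 1"] by (simp add: emeasure_space_1)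
    finally show ?thesis .
  qed
  have g_lim: "(\<lambda>k. g k x i) \<longlonglongrightarrow> w x i" for x i
  proof (rule LIMSEQ_I)
    fix e :: real assume "e > 0"
    then obtain N where N: "inverse (real (Suc N)) < e" using reals_Archimedean by blast
    show "\<exists>N. \<forall>k\<ge>N. norm (g k x i - w x i) < e"
    proof (intro exI allI impI)
      fix k assume "N \<le> k"
      let ?a = "real (Suc k)"
      have "?a * w x i - 1 < \<lfloor>?a * w x i\<rfloor>" "\<lfloor>?a * w x i\<rfloor> \<le> ?a * w x i" by linarith+
      then have "\<bar>real_of_int \<lfloor>?a * w x i\<rfloor> - ?a * w x i\<bar> \<le> 1" by linarith
      moreover have "g k x i - w x i = (real_of_int \<lfloor>?a * w x i\<rfloor> - ?a * w x i) / ?a"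
        by (simp add: g_def field_simps)
      ultimately have "\<bar>g k x i - w x i\<bar> \<le> 1 / ?a"
        by (simp add: abs_divide divide_right_mono)
      also have "\<dots> \<le> inverse (real (Suc N))" using \<open>N \<le> k\<close> by (simp add: field_simps)
      finally show "norm (g k x i - w x i) < e" using N by simp
    qed
  qed
  have lim: "(\<lambda>k. ennreal (exp (\<phi> (g k x) x))) \<longlonglongrightarrow> ennreal (exp (\<phi> (w x) x))" for x
    unfolding \<phi>_def by (intro tendsto_intros g_lim)
  have "(\<integral>\<^sup>+x. ennreal (exp (\<phi> (w x) x)) \<partial>?Q) = (\<integral>\<^sup>+x. liminf (\<lambda>k. ennreal (exp (\<phi> (g k x) x))) \<partial>?Q)"
    by (intro nn_integral_cong lim_imp_Liminf[symmetric] lim) simp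
  also have "\<dots> \<le> liminf (\<lambda>k. \<integral>\<^sup>+x. ennreal (exp (\<phi> (g k x) x)) \<partial>?Q)"
    by (rule nn_integral_liminf) measurable
  also have "\<dots> = 1" by (simp add: disc Liminf_const)
  finally show ?thesis by (simp add: \<phi>_def)
qed

subsection \<open>Norms of sketched vectors\<close>

text \<open>Multiplying the density by \<open>exp (t * x^2)\<close> gives, up to the factor
  \<open>1 / u\<close>, a centred normal density of standard deviation \<open>\<sigma> / u\<close>;
  this is the moment generating function of a scaled chi-square variable.\<close>

lemma nn_integral_gauss_measure_exp_square:
  assumes "\<sigma> > 0" "2 * t * \<sigma>\<^sup>2 < 1"
  shows "(\<integral>\<^sup>+x. ennreal (exp (t * x\<^sup>2)) \<partial>gauss_measure 0 \<sigma>) = ennreal (1 / sqrt (1 - 2 * t * \<sigma>\<^sup>2))"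
proof -
  define u where "u = sqrt (1 - 2 * t * \<sigma>\<^sup>2)"
  have u: "u > 0" "u\<^sup>2 = 1 - 2 * t * \<sigma>\<^sup>2" using assms(2) by (auto simp: u_def)
  have "normal_density 0 \<sigma> x * exp (t * x\<^sup>2) = 1 / u * normal_density 0 (\<sigma> / u) x" for x
  proof -
    have "- (x - 0)\<^sup>2 / (2 * \<sigma>\<^sup>2) + t * x\<^sup>2 = - (x - 0)\<^sup>2 / (2 * (\<sigma> / u)\<^sup>2)"
    proof -
      have "- (x - 0)\<^sup>2 / (2 * (\<sigma> / u)\<^sup>2) = - x\<^sup>2 * u\<^sup>2 / (2 * \<sigma>\<^sup>2)"
        using u(1) by (simp add: power_divide)
      also have "\<dots> = - x\<^sup>2 * (1 - 2 * t * \<sigma>\<^sup>2) / (2 * \<sigma>\<^sup>2)" by (simp only: u(2))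
      also have "\<dots> = - (x - 0)\<^sup>2 / (2 * \<sigma>\<^sup>2) + t * x\<^sup>2"
        using assms(1) by (simp add: diff_divide_distrib right_diff_distrib)
      finally show ?thesis by simp
    qed
    moreover have "1 / sqrt (2 * pi * \<sigma>\<^sup>2) = 1 / u * (1 / sqrt (2 * pi * (\<sigma> / u)\<^sup>2))"
      using assms(1) u(1) by (simp add: real_sqrt_mult real_sqrt_divide power_divide field_simps)
    ultimately show ?thesis by (simp add: normal_density_def flip: exp_add)
  qed
  then have "(\<integral>\<^sup>+x. ennreal (exp (t * x\<^sup>2)) \<partial>gauss_measure 0 \<sigma>)
      = (\<integral>\<^sup>+x. ennreal (1 / u) * ennreal (normal_density 0 (\<sigma> / u) x) \<partial>lborel)"
    unfolding gauss_measure_def using u(1)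
    by (subst nn_integral_density) (auto simp flip: ennreal_mult' intro!: nn_integral_cong)
  also have "\<dots> = ennreal (1 / u) * (\<integral>\<^sup>+x. ennreal (normal_density 0 (\<sigma> / u) x) \<partial>lborel)"
    by (rule nn_integral_cmult) simp
  also have "(\<integral>\<^sup>+x. ennreal (normal_density 0 (\<sigma> / u) x) \<partial>lborel) = 1"
    using assms(1) u(1) by (subst nn_integral_eq_integral) (auto simp: integral_normal_density integrable_normal_density)
  finally show ?thesis by (simp add: u_def)
qed

text \<open>Independence means that the joint law is the product of the marginals, and here the
  joint law is the product measure itself. Positive \<open>m\<close> and \<open>n\<close> keep the
  index set nonempty, as that characterisation demands.\<close>

lemma indep_vars_gauss_matrix_entries:
  assumes "\<sigma> > 0" "m > 0" "n > 0"
  shows "prob_space.indep_vars (gauss_matrix m n \<sigma>) (\<lambda>_. gauss_measure 0 \<sigma>) (\<lambda>p x. x p) ({..<m} \<times> {..<n})"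
proof -
  let ?Q = "gauss_matrix m n \<sigma>" and ?I = "{..<m} \<times> {..<n}"
  interpret prob_space ?Q using assms(1) by (rule prob_space_gauss_matrix)
  have "distr ?Q (PiM ?I (\<lambda>_. gauss_measure 0 \<sigma>)) (\<lambda>x. \<lambda>p\<in>?I. x p) = distr ?Q ?Q (\<lambda>x. x)"
    by (rule distr_cong) (auto simp: gauss_matrix_def space_PiM)
  also have "\<dots> = (\<Pi>\<^sub>M p\<in>?I. distr ?Q (gauss_measure 0 \<sigma>) (\<lambda>x. x p))"
    unfolding gauss_matrix_def using assms(1)
    by (auto simp: distr_PiM_component[where M="\<lambda>_. gauss_measure 0 \<sigma>"] prob_space_gauss_measure intro!: PiM_cong)
  finally show ?thesis
    using assms(2,3) by (subst indep_vars_iff_distr_eq_PiM') (auto simp: gauss_matrix_def)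
qed

text \<open>The zero entries of \<open>y\<close> are skipped because the library's addition theorem for independent
  normals requires nondegenerate summands.\<close>

lemma distr_gauss_matrix_row:
  fixes y :: "nat \<Rightarrow> real"
  assumes "\<sigma> > 0" "i < m" "(\<Sum>j<n. (y j)\<^sup>2) = 1"
  shows "distr (gauss_matrix m n \<sigma>) borel (\<lambda>x. \<Sum>j<n. x (i, j) * y j) = gauss_measure 0 \<sigma>"
proof -
  let ?Q = "gauss_matrix m n \<sigma>"
  interpret prob_space ?Q using assms(1) by (rule prob_space_gauss_matrix)
  define J where "J = {j\<in>{..<n}. y j \<noteq> 0}"
  have fin: "finite J" by (simp add: J_def)
  have "J \<noteq> {}"
  proof
    assume "J = {}"
    then have "(\<Sum>j<n. (y j)\<^sup>2) = 0" by (intro sum.neutral) (auto simp: J_def)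
    with assms(3) show False by simp
  qed
  then have "n > 0" by (auto simp: J_def)
  have coord: "distributed ?Q lborel (\<lambda>x. x p) (normal_density 0 \<sigma>)" if "p \<in> {..<m} \<times> {..<n}" for p
  proof -
    have "distr ?Q (gauss_measure 0 \<sigma>) (\<lambda>x. x p) = gauss_measure 0 \<sigma>"
      unfolding gauss_matrix_def using that assms(1) by (intro distr_PiM_component prob_space_gauss_measure)
    moreover have "distr ?Q (gauss_measure 0 \<sigma>) (\<lambda>x. x p) = distr ?Q lborel (\<lambda>x. x p)"
      by (rule distr_cong) auto
    moreover have "(\<lambda>x. x p) \<in> measurable ?Q lborel"
      using that by (subst measurable_cong_sets[OF sets_gauss_matrix sets_lborel]) (rule measurable_component_singleton)
    ultimately show ?thesis by (auto simp: distributed_def gauss_measure_def)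
  qed
  have "indep_vars (\<lambda>_. gauss_measure 0 \<sigma>) (\<lambda>p x. x p) ({..<m} \<times> {..<n})"
    using assms \<open>n > 0\<close> by (intro indep_vars_gauss_matrix_entries) auto
  \<comment> \<open>Grouping into blocks of a single entry re-indexes the family from pairs to the
    columns \<open>j\<close> of the fixed row \<open>i\<close>.\<close>
  then have "indep_vars (\<lambda>j. PiM {(i, j)} (\<lambda>_. gauss_measure 0 \<sigma>)) (\<lambda>j x. restrict (\<lambda>p. x p) {(i, j)}) J"
    by (rule indep_vars_restrict) (use assms(2) in \<open>auto simp: J_def disjoint_family_on_def\<close>)
  then have "indep_vars (\<lambda>_. borel) (\<lambda>j x. restrict (\<lambda>p. x p) {(i, j)} (i, j) * y j) J"
  proof (rule indep_vars_compose2[where Y="\<lambda>j f. f (i, j) * y j"])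
    fix j :: nat
    have [measurable]: "(\<lambda>f. f (i, j)) \<in> borel_measurable (PiM {(i, j)} (\<lambda>_. gauss_measure 0 \<sigma>))"
      using measurable_component_singleton[of "(i, j)" "{(i, j)}" "\<lambda>_. gauss_measure 0 \<sigma>"] by simp
    show "(\<lambda>f. f (i, j) * y j) \<in> borel_measurable (PiM {(i, j)} (\<lambda>_. gauss_measure 0 \<sigma>))"
      by measurable
  qed
  moreover have "distributed ?Q lborel (\<lambda>x. x (i, j) * y j) (normal_density 0 (\<bar>y j\<bar> * \<sigma>))" if "j \<in> J" for j
    using normal_density_affine[OF coord[of "(i, j)"] assms(1), of "y j" 0] that assms(2)
    by (auto simp: J_def mult.commute)
  ultimately have "distributed ?Q lborel (\<lambda>x. \<Sum>j\<in>J. x (i, j) * y j)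
      (normal_density (\<Sum>j\<in>J. 0) (sqrt (\<Sum>j\<in>J. (\<bar>y j\<bar> * \<sigma>)\<^sup>2)))"
    using assms(1) by (intro sum_indep_normal fin \<open>J \<noteq> {}\<close>) (auto simp: J_def)
  moreover have "(\<Sum>j\<in>J. x (i, j) * y j) = (\<Sum>j<n. x (i, j) * y j)" for x
    by (rule sum.mono_neutral_left) (auto simp: J_def)
  moreover have "sqrt (\<Sum>j\<in>J. (\<bar>y j\<bar> * \<sigma>)\<^sup>2) = \<sigma>"
  proof -
    have "(\<Sum>j\<in>J. (y j)\<^sup>2) = 1"
      unfolding assms(3)[symmetric] by (rule sum.mono_neutral_left) (auto simp: J_def)
    then show ?thesis using assms(1) by (simp add: power_mult_distrib flip: sum_distrib_right)
  qed
  ultimately have "distr ?Q lborel (\<lambda>x. \<Sum>j<n. x (i, j) * y j) = gauss_measure 0 \<sigma>"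
    by (simp add: distributed_def gauss_measure_def)
  moreover have "distr ?Q lborel (\<lambda>x. \<Sum>j<n. x (i, j) * y j) = distr ?Q borel (\<lambda>x. \<Sum>j<n. x (i, j) * y j)"
    by (rule distr_cong) auto
  ultimately show ?thesis by simp
qed

lemma gauss_matrix_row_measurable [measurable]:
  assumes "i < m"
  shows "(\<lambda>x. \<Sum>j<n. x (i, j) * y j) \<in> borel_measurable (gauss_matrix m n \<sigma>)"
proof -
  have [measurable]: "(\<lambda>x. x (i, j)) \<in> borel_measurable (gauss_matrix m n \<sigma>)" if "j \<in> {..<n}" for j
    using that assms by (subst measurable_cong_sets[OF sets_gauss_matrix refl]) (auto intro!: measurable_component_singleton)
  show ?thesis by measurable
qed

lemma indep_vars_gauss_matrix_rows:
  assumes "\<sigma> > 0" "m > 0" "n > 0"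
  shows "prob_space.indep_vars (gauss_matrix m n \<sigma>) (\<lambda>_. borel) (\<lambda>i x. \<Sum>j<n. x (i, j) * y j) {..<m}"
proof -
  let ?Q = "gauss_matrix m n \<sigma>"
  interpret prob_space ?Q using assms(1) by (rule prob_space_gauss_matrix)
  have "indep_vars (\<lambda>_. gauss_measure 0 \<sigma>) (\<lambda>p x. x p) ({..<m} \<times> {..<n})"
    using assms by (intro indep_vars_gauss_matrix_entries) auto
  then have "indep_vars (\<lambda>i. PiM ({i} \<times> {..<n}) (\<lambda>_. gauss_measure 0 \<sigma>))
      (\<lambda>i x. restrict (\<lambda>p. x p) ({i} \<times> {..<n})) {..<m}"
    by (rule indep_vars_restrict) (auto simp: disjoint_family_on_def)
  then have "indep_vars (\<lambda>_. borel) (\<lambda>i x. \<Sum>j<n. restrict (\<lambda>p. x p) ({i} \<times> {..<n}) (i, j) * y j) {..<m}"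
  proof (rule indep_vars_compose2[where Y="\<lambda>i f. \<Sum>j<n. f (i, j) * y j"])
    fix i
    have [measurable]: "(\<lambda>f. f (i, j)) \<in> borel_measurable (PiM ({i} \<times> {..<n}) (\<lambda>_. gauss_measure 0 \<sigma>))"
      if "j \<in> {..<n}" for j
      using that measurable_component_singleton[of "(i, j)" "{i} \<times> {..<n}" "\<lambda>_. gauss_measure 0 \<sigma>"] by simp
    show "(\<lambda>f. \<Sum>j<n. f (i, j) * y j) \<in> borel_measurable (PiM ({i} \<times> {..<n}) (\<lambda>_. gauss_measure 0 \<sigma>))"
      by measurable
  qed
  then show ?thesis by simp
qed

lemma nn_integral_gauss_matrix_exp_square:
  fixes y :: "nat \<Rightarrow> real"
  assumes "\<sigma> > 0" "m > 0" "(\<Sum>j<n. (y j)\<^sup>2) = 1" "2 * t * \<sigma>\<^sup>2 < 1"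
  shows "(\<integral>\<^sup>+x. ennreal (exp (t * (\<Sum>i<m. (\<Sum>j<n. x (i, j) * y j)\<^sup>2))) \<partial>gauss_matrix m n \<sigma>)
       = ennreal ((1 / sqrt (1 - 2 * t * \<sigma>\<^sup>2)) ^ m)"
proof -
  let ?Q = "gauss_matrix m n \<sigma>" and ?Z = "\<lambda>i x. \<Sum>j<n. x (i, j) * y j"
  interpret prob_space ?Q using assms(1) by (rule prob_space_gauss_matrix)
  have "n > 0" using assms(3) by (cases n) auto
  have "(\<integral>\<^sup>+x. ennreal (exp (t * (\<Sum>i<m. (?Z i x)\<^sup>2))) \<partial>?Q) = (\<integral>\<^sup>+x. (\<Prod>i<m. ennreal (exp (t * (?Z i x)\<^sup>2))) \<partial>?Q)"
    by (simp add: sum_distrib_left exp_sum prod_ennreal)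
  also have "\<dots> = (\<Prod>i<m. \<integral>\<^sup>+x. ennreal (exp (t * (?Z i x)\<^sup>2)) \<partial>?Q)"
    by (rule indep_vars_nn_integral)
      (auto intro!: indep_vars_compose2[OF indep_vars_gauss_matrix_rows, OF assms(1,2) \<open>n > 0\<close>])
  also have "\<dots> = (\<Prod>i<m. ennreal (1 / sqrt (1 - 2 * t * \<sigma>\<^sup>2)))"
  proof (rule prod.cong[OF refl])
    fix i assume "i \<in> {..<m}"
    then have "(\<integral>\<^sup>+x. ennreal (exp (t * (?Z i x)\<^sup>2)) \<partial>?Q) = (\<integral>\<^sup>+z. ennreal (exp (t * z\<^sup>2)) \<partial>distr ?Q borel (?Z i))"
      by (subst nn_integral_distr) auto
    also have "\<dots> = ennreal (1 / sqrt (1 - 2 * t * \<sigma>\<^sup>2))"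
      using \<open>i \<in> {..<m}\<close> assms by (simp add: distr_gauss_matrix_row nn_integral_gauss_measure_exp_square)
    finally show "(\<integral>\<^sup>+x. ennreal (exp (t * (?Z i x)\<^sup>2)) \<partial>?Q) = ennreal (1 / sqrt (1 - 2 * t * \<sigma>\<^sup>2))" .
  qed
  also have "\<dots> = ennreal ((1 / sqrt (1 - 2 * t * \<sigma>\<^sup>2)) ^ m)"
    using assms(4) by (simp add: ennreal_power)
  finally show ?thesis .
qed

section \<open>Exponential Markov inequality and norm tails\<close>

lemma (in prob_space) prob_ge_le_exp:
  assumes [measurable]: "X \<in> borel_measurable M"
    and le: "(\<integral>\<^sup>+x. ennreal (exp (X x)) \<partial>M) \<le> ennreal B" and "B \<ge> 0"
  shows "prob {x\<in>space M. X x \<ge> t} \<le> B * exp (- t)"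
proof -
  have "emeasure M {x\<in>space M. X x \<ge> t} \<le> emeasure M {x\<in>space M. 1 \<le> ennreal (exp (- t)) * ennreal (exp (X x))}"
    by (rule emeasure_mono) (auto simp flip: ennreal_mult' exp_add)
  also have "\<dots> \<le> ennreal (exp (- t)) * (\<integral>\<^sup>+x. ennreal (exp (X x)) * indicator (space M) x \<partial>M)"
    by (rule nn_integral_Markov_inequality[where A="space M", simplified]) auto
  also have "(\<integral>\<^sup>+x. ennreal (exp (X x)) * indicator (space M) x \<partial>M) = (\<integral>\<^sup>+x. ennreal (exp (X x)) \<partial>M)"
    by (intro nn_integral_cong) auto
  also have "ennreal (exp (- t)) * \<dots> \<le> ennreal (exp (- t)) * ennreal B"
    using le by (rule mult_left_mono) simp
  also have "\<dots> = ennreal (B * exp (- t))"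
    using assms(3) by (simp add: mult.commute flip: ennreal_mult')
  finally show ?thesis
    using assms(3) by (simp add: emeasure_eq_measure)
qed

text \<open>Chernoff bounds with variance \<open>1 / m\<close>. The parameter \<open>m / 4\<close>
  makes \<open>1 - 2 * t * \<sigma>^2\<close> equal to \<open>1 / 2\<close>, and
  \<open>- 2 * m\<close> makes it equal to 5. In both cases each of the \<open>m\<close> independent
  rows contributes a factor of at most \<open>exp (- 1 / 4)\<close>.\<close>

lemma gauss_matrix_norm_tail:
  fixes y :: "nat \<Rightarrow> real"
  assumes "m > 0" "(\<Sum>j<n. (y j)\<^sup>2) = 1"
  defines "Q \<equiv> gauss_matrix m n (sqrt (1 / real m))"
  shows "measure Q {x\<in>space Q. (\<Sum>i<m. (\<Sum>j<n. x (i, j) * y j)\<^sup>2) \<ge> 4} \<le> exp (- (real m / 4))"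
    and "measure Q {x\<in>space Q. (\<Sum>i<m. (\<Sum>j<n. x (i, j) * y j)\<^sup>2) \<le> 1 / 4} \<le> exp (- (real m / 4))"
proof -
  let ?\<sigma> = "sqrt (1 / real m)" and ?N = "\<lambda>x. \<Sum>i<m. (\<Sum>j<n. x (i, j) * y j)\<^sup>2"
  have \<sigma>: "?\<sigma> > 0" using assms(1) by simp
  interpret prob_space Q unfolding Q_def using \<sigma> by (rule prob_space_gauss_matrix)
  have [measurable]: "?N \<in> borel_measurable Q"
    unfolding Q_def by (intro borel_measurable_sum borel_measurable_power gauss_matrix_row_measurable) auto
  \<comment> \<open>It suffices that \<open>sqrt 2\<close> is at most \<open>exp (3 / 4)\<close>;
    after squaring, \<open>(1 + 3 / 4)^2 > 2\<close> decides it.\<close>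
  have e1: "sqrt 2 * exp (- 1) \<le> exp (- (1 / 4 :: real))"
  proof -
    have "(exp (3 / 4 :: real))^2 \<ge> (1 + 3/4)^2" by (intro power_mono exp_ge_add_one_self) auto
    then have "sqrt 2 \<le> exp (3 / 4 :: real)" by (intro real_le_lsqrt) (auto simp: power2_eq_square)
    then have "sqrt 2 * exp (- 1) \<le> exp (3 / 4) * exp (- 1 :: real)" by (intro mult_right_mono) auto
    then show ?thesis by (simp flip: exp_add)
  qed
  have "prob {x\<in>space Q. real m / 4 * ?N x \<ge> real m} \<le> (1 / sqrt (1 / 2)) ^ m * exp (- real m)"
  proof (rule prob_ge_le_exp)
    show "(\<integral>\<^sup>+x. ennreal (exp (real m / 4 * ?N x)) \<partial>Q) \<le> ennreal ((1 / sqrt (1 / 2)) ^ m)"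
      unfolding Q_def using assms by (subst nn_integral_gauss_matrix_exp_square[OF \<sigma> assms(1,2)]) auto
  qed auto
  also have "{x\<in>space Q. real m / 4 * ?N x \<ge> real m} = {x\<in>space Q. ?N x \<ge> 4}"
    using assms(1) by (auto simp: field_simps)
  also have "(1 / sqrt (1 / 2)) ^ m * exp (- real m) = (sqrt 2 * exp (- 1)) ^ m"
    by (simp add: real_sqrt_divide power_mult_distrib flip: exp_of_nat_mult)
  also have "\<dots> \<le> exp (- (1 / 4)) ^ m" using e1 by (intro power_mono) auto
  also have "\<dots> = exp (- (real m / 4))" by (simp flip: exp_of_nat_mult)
  finally show "prob {x\<in>space Q. ?N x \<ge> 4} \<le> exp (- (real m / 4))" .
  \<comment> \<open>It suffices that \<open>exp (3 / 4)\<close> is at most \<open>sqrt 5\<close>;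
    fourth powers reduce this to \<open>exp 3 < 2.75^3 < 25\<close>.\<close>
  have e2: "1 / sqrt 5 * exp (1 / 2) \<le> exp (- (1 / 4 :: real))"
  proof -
    have "(exp (3 / 4 :: real))^4 = (exp 1)^3" by (simp flip: exp_of_nat_mult)
    also have "\<dots> \<le> 2.75 ^ 3" using e_less_272 by (intro power_mono) auto
    also have "\<dots> \<le> (sqrt 5)^4" by (simp add: power4_eq_xxxx power3_eq_cube)
    finally have "exp (3 / 4 :: real) \<le> sqrt 5" by (rule power_le_imp_le_base[of _ 3, simplified]) auto
    then have "exp (3 / 4) * exp (- (1 / 4)) \<le> sqrt 5 * exp (- (1 / 4) :: real)" by (intro mult_right_mono) auto
    then have "exp (1 / 2) \<le> sqrt 5 * exp (- (1 / 4) :: real)" by (simp flip: exp_add)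
    then show ?thesis by (simp add: field_simps)
  qed
  have "prob {x\<in>space Q. - 2 * real m * ?N x \<ge> - (real m / 2)} \<le> (1 / sqrt 5) ^ m * exp (- (- (real m / 2)))"
  proof (rule prob_ge_le_exp)
    show "(\<integral>\<^sup>+x. ennreal (exp (- 2 * real m * ?N x)) \<partial>Q) \<le> ennreal ((1 / sqrt 5) ^ m)"
      unfolding Q_def using assms by (subst nn_integral_gauss_matrix_exp_square[OF \<sigma> assms(1,2)]) auto
  qed auto
  also have "{x\<in>space Q. - 2 * real m * ?N x \<ge> - (real m / 2)} = {x\<in>space Q. ?N x \<le> 1 / 4}"
    using assms(1) by (auto simp: field_simps)
  also have "(1 / sqrt 5) ^ m * exp (- (- (real m / 2))) = (1 / sqrt 5 * exp (1 / 2)) ^ m"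
    by (simp add: power_divide flip: exp_of_nat_mult)
  also have "\<dots> \<le> exp (- (1 / 4)) ^ m" using e2 by (intro power_mono) auto
  also have "\<dots> = exp (- (real m / 4))" by (simp flip: exp_of_nat_mult)
  finally show "prob {x\<in>space Q. ?N x \<le> 1 / 4} \<le> exp (- (real m / 4))" .
qed

subsection \<open>A lattice net\<close>

text \<open>The budget is on the sum of absolute values rather than of squares because the weight
  \<open>2 ^ (- sum)\<close> then factors over the coordinates when points are counted. Extensional
  functions make the set finite.\<close>

definition lattice_points :: "nat \<Rightarrow> nat \<Rightarrow> (nat \<Rightarrow> int) set" where
  "lattice_points k R = {q \<in> {..<k} \<rightarrow>\<^sub>E UNIV. (\<Sum>i<k. nat \<bar>q i\<bar>) \<le> R}"

lemma lattice_points_subset: "lattice_points k R \<subseteq> {..<k} \<rightarrow>\<^sub>E {- int R..int R}"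
proof
  fix q assume q: "q \<in> lattice_points k R"
  have "\<bar>q i\<bar> \<le> int R" if "i < k" for i
  proof -
    have "nat \<bar>q i\<bar> \<le> (\<Sum>i<k. nat \<bar>q i\<bar>)" using that by (intro member_le_sum) auto
    also have "\<dots> \<le> R" using q by (simp add: lattice_points_def)
    finally show ?thesis by simp
  qed
  then have "q i \<in> {- int R..int R}" if "i < k" for i using that[THEN \<open>\<And>i. i < k \<Longrightarrow> \<bar>q i\<bar> \<le> int R\<close>] by auto
  then show "q \<in> {..<k} \<rightarrow>\<^sub>E {- int R..int R}" using q by (auto simp: lattice_points_def PiE_iff)
qed

lemma finite_lattice_points: "finite (lattice_points k R)"
  by (rule finite_subset[OF lattice_points_subset]) (intro finite_PiE, auto)

lemma sum_half_power_abs_le: "(\<Sum>z = - int R..int R. (1 / 2 :: real) ^ nat \<bar>z\<bar>) \<le> 3"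
proof -
  \<comment> \<open>The exact value carries the induction; the two new end points each add half of
    the gap to 3.\<close>
  have "(\<Sum>z = - int R..int R. (1 / 2 :: real) ^ nat \<bar>z\<bar>) = 3 - 2 * (1 / 2) ^ R"
  proof (induction R)
    case (Suc R)
    have "{- int (Suc R)..int (Suc R)} = insert (- int (Suc R)) (insert (int (Suc R)) {- int R..int R})"
      by auto
    then show ?case using Suc by (simp add: nat_add_distrib)
  qed simp
  then show ?thesis by simp
qed

text \<open>Weighting \<open>q\<close> by \<open>2 ^ (R - sum of the entries)\<close> decouples the coordinates.\<close>

lemma card_lattice_points_le: "real (card (lattice_points k R)) \<le> 2 ^ R * 3 ^ k"
proof -
  let ?w = "\<lambda>q. \<Prod>i<k. (1 / 2 :: real) ^ nat \<bar>q i\<bar>"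
  have "real (card (lattice_points k R)) = (\<Sum>q\<in>lattice_points k R. 1)" by simp
  also have "\<dots> \<le> (\<Sum>q\<in>lattice_points k R. 2 ^ R * ?w q)"
  proof (rule sum_mono)
    fix q assume "q \<in> lattice_points k R"
    then have "(1 / 2 :: real) ^ R \<le> (1 / 2) ^ (\<Sum>i<k. nat \<bar>q i\<bar>)"
      by (intro power_decreasing) (auto simp: lattice_points_def)
    then have "2 ^ R * (1 / 2 :: real) ^ R \<le> 2 ^ R * ?w q"
      by (intro mult_left_mono) (auto simp: power_sum)
    then show "1 \<le> 2 ^ R * ?w q" by (simp flip: power_mult_distrib)
  qed
  also have "\<dots> \<le> (\<Sum>q\<in>{..<k} \<rightarrow>\<^sub>E {- int R..int R}. 2 ^ R * ?w q)"
  proof (rule sum_mono2[OF _ lattice_points_subset])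
    show "finite ({..<k} \<rightarrow>\<^sub>E {- int R..int R})" by (intro finite_PiE) auto
    show "0 \<le> 2 ^ R * ?w q" for q by (intro mult_nonneg_nonneg prod_nonneg) auto
  qed
  also have "\<dots> = 2 ^ R * (\<Prod>i<k. \<Sum>z = - int R..int R. (1 / 2) ^ nat \<bar>z\<bar>)"
    by (subst prod_sum_PiE) (simp_all only: sum_distrib_left finite_lessThan finite_atLeastAtMost_int)
  also have "\<dots> \<le> 2 ^ R * (\<Prod>i<k. 3)"
    by (intro mult_left_mono prod_mono conjI sum_half_power_abs_le sum_nonneg) auto
  finally show ?thesis by simp
qed

text \<open>The mesh is chosen so that \<open>k \<le> d\<close> coordinate errors of at most
  \<open>h\<close> have Euclidean norm at most \<open>1 / 10\<close>. A lattice vector in the unit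
  ball has integer coordinates with sum of squares at most \<open>1 / h^2 = 100 d\<close>; since an
  integer is bounded in absolute value by its square, the same budget bounds the sum of absolute
  values.\<close>

lemma lattice_approximation:
  fixes z :: "nat \<Rightarrow> real"
  assumes "d > 0" "k \<le> d" "L2_set z {..<k} \<le> 1"
  defines "h \<equiv> 1 / (10 * sqrt (real d))"
  obtains q where "q \<in> lattice_points k (100 * d)"
    and "L2_set (\<lambda>i. z i - h * real_of_int (q i)) {..<k} \<le> 1 / 10"
    and "L2_set (\<lambda>i. h * real_of_int (q i)) {..<k} \<le> 1"
proof -
  have h: "h > 0" and h2: "h\<^sup>2 = 1 / (100 * real d)"
    using assms(1) by (auto simp: h_def power_divide power_mult_distrib)
  \<comment> \<open>Rounding towards zero never increases a coordinate in absolute value, so the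
    lattice vector stays in the unit ball.\<close>
  define rnd where "rnd t = (if t \<ge> 0 then \<lfloor>t\<rfloor> else \<lceil>t\<rceil>)" for t :: real
  have rnd: "\<bar>t - rnd t\<bar> \<le> 1" "\<bar>real_of_int (rnd t)\<bar> \<le> \<bar>t\<bar>" for t
    unfolding rnd_def by (auto split: if_splits) linarith+
  define q where "q = (\<lambda>i\<in>{..<k}. rnd (z i / h))"
  have near: "\<bar>z i - h * real_of_int (q i)\<bar> \<le> h" if "i < k" for i
  proof -
    have "z i - h * real_of_int (q i) = h * (z i / h - rnd (z i / h))"
      using h that by (simp add: q_def right_diff_distrib)
    then have "\<bar>z i - h * real_of_int (q i)\<bar> = h * \<bar>z i / h - rnd (z i / h)\<bar>"
      using h by (simp add: abs_mult)
    also have "\<dots> \<le> h * 1" using h rnd(1) by (intro mult_left_mono) auto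
    finally show ?thesis by simp
  qed
  have small: "\<bar>h * real_of_int (q i)\<bar> \<le> \<bar>z i\<bar>" if "i < k" for i
  proof -
    have "\<bar>h * real_of_int (q i)\<bar> \<le> h * \<bar>z i / h\<bar>"
      unfolding abs_mult using h that mult_left_mono[OF rnd(2)[of "z i / h"], of h] by (simp add: q_def)
    then show ?thesis using h by simp
  qed
  have "L2_set (\<lambda>i. h * real_of_int (q i)) {..<k} = L2_set (\<lambda>i. \<bar>h * real_of_int (q i)\<bar>) {..<k}"
    by (simp add: L2_set_def)
  also have "\<dots> \<le> L2_set (\<lambda>i. \<bar>z i\<bar>) {..<k}"
    using small by (intro L2_set_mono) auto
  also have "\<dots> \<le> 1" using assms(3) by (simp add: L2_set_def)
  finally have norm_q: "L2_set (\<lambda>i. h * real_of_int (q i)) {..<k} \<le> 1" .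
  have "L2_set (\<lambda>i. z i - h * real_of_int (q i)) {..<k} \<le> L2_set (\<lambda>i. h) {..<k}"
    using L2_set_mono[of "{..<k}" "\<lambda>i. \<bar>z i - h * real_of_int (q i)\<bar>" "\<lambda>i. h"] near h by (simp add: L2_set_def)
  also have "\<dots> = sqrt (real k * h\<^sup>2)" by (simp add: L2_set_def)
  also have "\<dots> \<le> sqrt ((1 / 10)\<^sup>2)"
    using assms(1,2) by (intro real_sqrt_le_mono) (simp add: h2 field_simps power_divide)
  finally have err: "L2_set (\<lambda>i. z i - h * real_of_int (q i)) {..<k} \<le> 1 / 10" by simp
  have "(\<Sum>i<k. (h * real_of_int (q i))\<^sup>2) \<le> 1"
    using norm_q by (simp add: L2_set_def real_sqrt_le_1_iff)
  then have "(\<Sum>i<k. (real_of_int (q i))\<^sup>2) \<le> 100 * real d"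
  proof -
    have "(\<Sum>i<k. (h * real_of_int (q i))\<^sup>2) = h\<^sup>2 * (\<Sum>i<k. (real_of_int (q i))\<^sup>2)"
      by (simp only: power_mult_distrib sum_distrib_left)
    with \<open>(\<Sum>i<k. (h * real_of_int (q i))\<^sup>2) \<le> 1\<close> show ?thesis
      using assms(1) by (simp add: h2 pos_divide_le_eq)
  qed
  then have "real_of_int (\<Sum>i<k. (q i)\<^sup>2) \<le> real_of_int (int (100 * d))" by simp
  then have le: "(\<Sum>i<k. (q i)\<^sup>2) \<le> int (100 * d)" by (simp only: of_int_le_iff)
  have "int (\<Sum>i<k. nat \<bar>q i\<bar>) = (\<Sum>i<k. \<bar>q i\<bar>)" by simp
  also have "\<dots> \<le> (\<Sum>i<k. (q i)\<^sup>2)"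
  proof (rule sum_mono)
    fix i
    show "\<bar>q i\<bar> \<le> (q i)\<^sup>2"
    proof (cases "q i = 0")
      case False
      then have "1 \<le> \<bar>q i\<bar>" by linarith
      from mult_left_mono[OF this, of "\<bar>q i\<bar>"] show ?thesis by (simp add: power2_eq_square)
    qed simp
  qed
  finally have "(\<Sum>i<k. nat \<bar>q i\<bar>) \<le> 100 * d" using le by linarith
  then have "q \<in> lattice_points k (100 * d)" by (simp add: lattice_points_def q_def)
  with err norm_q that show ?thesis by blast
qed

text \<open>The usual net argument: upper bounds at net points control the supremum on the ball,
  because the approximation error is again a vector of the ball scaled by \<open>1 / 10\<close>.
  With the supremum known, lower bounds at net points extend to all vectors. The constant
  \<open>B\<close> serves to make the supremum finite and does not enter the result.\<close>

lemma seminorm_lower_bound_from_lattice: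
  fixes F :: "(nat \<Rightarrow> real) \<Rightarrow> real"
  assumes "d > 0" "k \<le> d"
    and scale: "\<And>c x. F (\<lambda>i. c * x i) = \<bar>c\<bar> * F x"
    and triangle: "\<And>x y. F (\<lambda>i. x i + y i) \<le> F x + F y"
    and bounded: "\<And>x. F x \<le> B * L2_set x {..<k}"
  defines "h \<equiv> 1 / (10 * sqrt (real d))"
  assumes lower: "\<And>q. q \<in> lattice_points k (100 * d) \<Longrightarrow>
      L2_set (\<lambda>i. h * real_of_int (q i)) {..<k} / 2 \<le> F (\<lambda>i. h * real_of_int (q i))"
    and upper: "\<And>q. q \<in> lattice_points k (100 * d) \<Longrightarrow>
      F (\<lambda>i. h * real_of_int (q i)) \<le> 2 * L2_set (\<lambda>i. h * real_of_int (q i)) {..<k}"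
  shows "L2_set z {..<k} / 5 \<le> F z"
proof -
  let ?n = "\<lambda>x. L2_set x {..<k}"
  have n_scale: "?n (\<lambda>i. c * x i) = \<bar>c\<bar> * ?n x" for c x
    by (simp add: L2_set_def power_mult_distrib real_sqrt_mult flip: sum_distrib_left)
  have nonneg: "F x \<ge> 0" for x
    using triangle[of x "\<lambda>i. (- 1) * x i"] scale[of "-1" x] scale[of 0 x] by simp
  define \<Lambda> where "\<Lambda> = (SUP x\<in>{x. ?n x \<le> 1}. F x)"
  have bdd: "bdd_above (F ` {x. ?n x \<le> 1})"
  proof (rule bdd_aboveI2)
    fix x assume "x \<in> {x. ?n x \<le> 1}"
    have "F x \<le> \<bar>B\<bar> * ?n x"
      using bounded[of x] mult_right_mono[of B "\<bar>B\<bar>" "?n x"] by (simp add: L2_set_nonneg abs_ge_self)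
    also have "\<dots> \<le> \<bar>B\<bar> * 1" using \<open>x \<in> _\<close> by (intro mult_left_mono) auto
    finally show "F x \<le> \<bar>B\<bar>" by simp
  qed
  have \<Lambda>: "F x \<le> \<Lambda>" if "?n x \<le> 1" for x
    unfolding \<Lambda>_def using bdd that by (intro cSUP_upper) auto
  have tenth: "F x \<le> \<Lambda> / 10" if "?n x \<le> 1 / 10" for x
    using \<Lambda>[of "\<lambda>i. 10 * x i"] that by (simp add: n_scale scale)
  \<comment> \<open>The supremum bounds itself: a net point contributes at most 2 and the remainder
    at most a tenth of \<open>\<Lambda>\<close>.\<close>
  have "\<Lambda> \<le> 2 + \<Lambda> / 10"
  proof -
    have "(SUP x\<in>{x. ?n x \<le> 1}. F x) \<le> 2 + \<Lambda> / 10"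
    proof (rule cSUP_least)
      show "{x. ?n x \<le> 1} \<noteq> {}" by (auto intro!: exI[of _ "\<lambda>_. 0"] simp: L2_set_def)
      fix x assume "x \<in> {x. ?n x \<le> 1}"
      then obtain q where q: "q \<in> lattice_points k (100 * d)" "?n (\<lambda>i. x i - h * real_of_int (q i)) \<le> 1 / 10"
        "?n (\<lambda>i. h * real_of_int (q i)) \<le> 1"
        using lattice_approximation[OF assms(1,2), of x] unfolding h_def by blast
      have "F x \<le> F (\<lambda>i. h * real_of_int (q i)) + F (\<lambda>i. x i - h * real_of_int (q i))"
        using triangle[of "\<lambda>i. h * real_of_int (q i)" "\<lambda>i. x i - h * real_of_int (q i)"] by simp
      also have "\<dots> \<le> 2 + \<Lambda> / 10" using upper[OF q(1)] q(3) tenth[OF q(2)] by linarith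
      finally show "F x \<le> 2 + \<Lambda> / 10" .
    qed
    then show ?thesis by (simp add: \<Lambda>_def)
  qed
  then have \<Lambda>_le: "\<Lambda> \<le> 20 / 9" by simp
  \<comment> \<open>The net point near a unit vector has norm at least \<open>9 / 10\<close>, so
    \<open>F\<close> is at least \<open>9 / 20\<close> there. The error costs at most
    \<open>\<Lambda> / 10\<close>, hence at most \<open>2 / 9\<close>, and
    \<open>9 / 20 - 2 / 9 = 41 / 180\<close> exceeds \<open>1 / 5\<close>.\<close>
  have unit: "1 / 5 \<le> F x" if x: "?n x = 1" for x
  proof -
    obtain q where q: "q \<in> lattice_points k (100 * d)" "?n (\<lambda>i. x i - h * real_of_int (q i)) \<le> 1 / 10"
      using lattice_approximation[OF assms(1,2), of x] x unfolding h_def by auto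
    have "?n x \<le> ?n (\<lambda>i. h * real_of_int (q i)) + ?n (\<lambda>i. x i - h * real_of_int (q i))"
      using L2_set_triangle_ineq[of "\<lambda>i. h * real_of_int (q i)" "\<lambda>i. x i - h * real_of_int (q i)"] by simp
    moreover have "F (\<lambda>i. h * real_of_int (q i)) \<le> F x + F (\<lambda>i. (- 1) * (x i - h * real_of_int (q i)))"
      using triangle[of x "\<lambda>i. (- 1) * (x i - h * real_of_int (q i))"] by simp
    moreover have "F (\<lambda>i. (- 1) * (x i - h * real_of_int (q i))) = F (\<lambda>i. x i - h * real_of_int (q i))"
      using scale[of "- 1" "\<lambda>i. x i - h * real_of_int (q i)"] by simp
    ultimately show ?thesis using lower[OF q(1)] tenth[OF q(2)] q(2) x \<Lambda>_le by linarith
  qed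
  show ?thesis
  proof (cases "?n z = 0")
    case True then show ?thesis using nonneg by simp
  next
    case False
    then have pos: "?n z > 0" by (simp add: L2_set_nonneg less_le)
    have "1 / 5 \<le> F (\<lambda>i. 1 / ?n z * z i)"
      using pos n_scale[of "1 / ?n z" z] by (intro unit) simp
    from mult_left_mono[OF this, of "?n z"] have "?n z / 5 \<le> ?n z * F (\<lambda>i. 1 / ?n z * z i)"
      using pos by simp
    also have "\<dots> = F z" using pos scale[of "1 / ?n z" z] by simp
    finally show ?thesis .
  qed
qed

subsection \<open>Linear algebra and the pseudoinverse\<close>

lemma euclid_norm_eq_L2_set: "euclid_norm v = L2_set (\<lambda>i. v $ i) {..<dim_vec v}"
  by (simp add: euclid_norm_def L2_set_def scalar_prod_def power2_eq_square atLeast0LessThan)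

lemma euclid_norm_nonneg [simp]: "euclid_norm v \<ge> 0"
  by (simp add: euclid_norm_eq_L2_set L2_set_nonneg)

lemma euclid_norm_power2: "(euclid_norm v)\<^sup>2 = v \<bullet> v"
  by (simp add: euclid_norm_def scalar_prod_def sum_nonneg)

lemma euclid_norm_smult: "euclid_norm (c \<cdot>\<^sub>v v) = \<bar>c\<bar> * euclid_norm v"
  by (simp add: euclid_norm_eq_L2_set L2_set_def power_mult_distrib real_sqrt_mult flip: sum_distrib_left)

lemma euclid_norm_eq_0_iff: "v \<in> carrier_vec n \<Longrightarrow> euclid_norm v = 0 \<longleftrightarrow> v = 0\<^sub>v n"
  by (auto simp: euclid_norm_eq_L2_set L2_set_eq_0_iff vec_eq_iff)

lemma euclid_norm_zero [simp]: "euclid_norm (0\<^sub>v n) = 0"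
  using euclid_norm_eq_0_iff[of "0\<^sub>v n" n] by simp

lemma euclid_norm_triangle:
  assumes "u \<in> carrier_vec n" "v \<in> carrier_vec n"
  shows "euclid_norm (u + v) \<le> euclid_norm u + euclid_norm v"
proof -
  have "euclid_norm (u + v) = L2_set (\<lambda>i. u $ i + v $ i) {..<n}"
    unfolding euclid_norm_eq_L2_set using assms by (intro L2_set_cong) auto
  then show ?thesis
    using assms L2_set_triangle_ineq[of "\<lambda>i. u $ i" "\<lambda>i. v $ i" "{..<n}"]
    by (simp add: euclid_norm_eq_L2_set)
qed

lemma abs_index_le_euclid_norm: "i < dim_vec v \<Longrightarrow> \<bar>v $ i\<bar> \<le> euclid_norm v"
  using member_le_L2_set[of "{..<dim_vec v}" i "\<lambda>i. \<bar>v $ i\<bar>"]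
  by (simp add: euclid_norm_eq_L2_set L2_set_def)

lemma abs_scalar_prod_le:
  assumes "u \<in> carrier_vec n" "v \<in> carrier_vec n"
  shows "\<bar>u \<bullet> v\<bar> \<le> euclid_norm u * euclid_norm v"
proof -
  have "\<bar>u \<bullet> v\<bar> \<le> (\<Sum>i<n. \<bar>u $ i\<bar> * \<bar>v $ i\<bar>)"
    using assms by (simp add: scalar_prod_def atLeast0LessThan abs_mult[symmetric] sum_abs)
  also have "\<dots> \<le> euclid_norm u * euclid_norm v"
    using assms L2_set_mult_ineq[of "\<lambda>i. u $ i" "\<lambda>i. v $ i" "{..<n}"]
    by (simp add: euclid_norm_eq_L2_set)
  finally show ?thesis .
qed

text \<open>A real supremum says something about the elements only when the set is bounded.
  Cauchy--Schwarz row by row gives the sum of the row norms as a crude bound.\<close>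

lemma spectral_norm_bdd_above:
  "bdd_above ((\<lambda>v. euclid_norm (M *\<^sub>v v)) ` {v \<in> carrier_vec (dim_col M). euclid_norm v \<le> 1})"
proof (rule bdd_aboveI2)
  fix v assume v: "v \<in> {v \<in> carrier_vec (dim_col M). euclid_norm v \<le> 1}"
  have "euclid_norm (M *\<^sub>v v) \<le> (\<Sum>i<dim_row M. \<bar>(M *\<^sub>v v) $ i\<bar>)"
    unfolding euclid_norm_eq_L2_set dim_mult_mat_vec by (rule L2_set_le_sum_abs)
  also have "\<dots> \<le> (\<Sum>i<dim_row M. euclid_norm (row M i))"
  proof (rule sum_mono)
    fix i assume "i \<in> {..<dim_row M}"
    then have "\<bar>(M *\<^sub>v v) $ i\<bar> \<le> euclid_norm (row M i) * euclid_norm v"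
      using v by (simp add: abs_scalar_prod_le[of _ "dim_col M"] row_def)
    also have "\<dots> \<le> euclid_norm (row M i) * 1" using v by (intro mult_left_mono) auto
    finally show "\<bar>(M *\<^sub>v v) $ i\<bar> \<le> euclid_norm (row M i)" by simp
  qed
  finally show "euclid_norm (M *\<^sub>v v) \<le> (\<Sum>i<dim_row M. euclid_norm (row M i))" .
qed

lemma spectral_norm_nonneg: "spectral_norm M \<ge> 0"
proof -
  have "euclid_norm (M *\<^sub>v 0\<^sub>v (dim_col M)) \<le> spectral_norm M"
    unfolding spectral_norm_def
    by (rule cSUP_upper[OF _ spectral_norm_bdd_above]) simp
  then show ?thesis using euclid_norm_nonneg order_trans by blast
qed

lemma euclid_norm_mult_mat_vec_le:
  assumes "M \<in> carrier_mat r c" "v \<in> carrier_vec c"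
  shows "euclid_norm (M *\<^sub>v v) \<le> spectral_norm M * euclid_norm v"
proof (cases "euclid_norm v = 0")
  case True
  then have "v = 0\<^sub>v c" using assms by (simp add: euclid_norm_eq_0_iff)
  then have "M *\<^sub>v v = 0\<^sub>v r" using assms by auto
  then show ?thesis using True by simp
next
  case False
  then have pos: "euclid_norm v > 0" by (simp add: less_le)
  let ?u = "(1 / euclid_norm v) \<cdot>\<^sub>v v"
  have "euclid_norm (M *\<^sub>v ?u) \<le> spectral_norm M"
    unfolding spectral_norm_def
    by (rule cSUP_upper[OF _ spectral_norm_bdd_above]) (use assms pos in \<open>simp add: euclid_norm_smult\<close>)
  moreover have "M *\<^sub>v ?u = (1 / euclid_norm v) \<cdot>\<^sub>v (M *\<^sub>v v)"
    using assms by (rule mult_mat_vec)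
  ultimately show ?thesis using pos by (simp add: euclid_norm_smult field_simps)
qed

text \<open>Linear independence concerns the set of columns, so repeated columns have to be excluded
  first: a maximal independent subset of that set has as many elements as the rank, which is the
  number of columns.\<close>

lemma full_rank_imp_inj:
  fixes A :: "real mat"
  assumes A: "A \<in> carrier_mat n d" and rank: "vec_space.rank n A = d"
    and x: "x \<in> carrier_vec d" "A *\<^sub>v x = 0\<^sub>v n"
  shows "x = 0\<^sub>v d"
proof -
  interpret vec_space "TYPE(real)" n .
  have "distinct (cols A)"
  proof -
    obtain T where T: "maximal T (\<lambda>T. T \<subseteq> set (cols A) \<and> lin_indpt T)"
      using maximal_exists[of "\<lambda>T. T \<subseteq> set (cols A) \<and> lin_indpt T" "card (set (cols A))" "{}"]
      by (meson List.finite_set card_mono empty_iff empty_subsetI finite_lin_indpt2 rev_finite_subset)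
    then have "card T \<le> card (set (cols A))" by (simp add: card_mono maximal_def)
    then have "length (cols A) \<le> card (set (cols A))"
      using rank_card_indpt[OF A T] rank A by simp
    then show ?thesis using card_distinct card_length order_antisym by blast
  qed
  then show ?thesis
    using lin_depI[OF A x(1) _ x(2)] full_rank_lin_indpt[OF A rank] by blast
qed

text \<open>Vectors are functions here because the number of basis vectors grows along the induction.\<close>

lemma gram_schmidt_exists:
  fixes v :: "nat \<Rightarrow> nat \<Rightarrow> real"
  obtains k u c where "k \<le> d"
    and "\<And>i j. i < k \<Longrightarrow> j < k \<Longrightarrow> (\<Sum>l<n. u i l * u j l) = (if i = j then 1 else 0)"
    and "\<And>i l. i < k \<Longrightarrow> l < n \<Longrightarrow> u i l = (\<Sum>j<d. c i j * v j l)"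
    and "\<And>j l. j < d \<Longrightarrow> l < n \<Longrightarrow> v j l = (\<Sum>i<k. (\<Sum>l<n. u i l * v j l) * u i l)"
proof -
  let ?ip = "\<lambda>x y. \<Sum>l<n. x l * y l :: real"
  \<comment> \<open>The coefficients \<open>c\<close>, which express the basis through the given
    vectors, are recorded along with the expansion in the other direction because they later form
    the entries of a least-squares inverse.\<close>
  have "\<exists>k u c. k \<le> d \<and>
     (\<forall>i<k. \<forall>j<k. ?ip (u i) (u j) = (if i = j then 1 else 0)) \<and>
     (\<forall>i<k. \<forall>l<n. u i l = (\<Sum>j<d. c i j * v j l)) \<and>
     (\<forall>j<d. \<forall>l<n. v j l = (\<Sum>i<k. ?ip (u i) (v j) * u i l))"
  proof (induction d)
    case 0
    show ?case by auto
  next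
    case (Suc d)
    then obtain k u c where k: "k \<le> d"
      and on: "\<forall>i<k. \<forall>j<k. ?ip (u i) (u j) = (if i = j then 1 else 0)"
      and comb: "\<forall>i<k. \<forall>l<n. u i l = (\<Sum>j<d. c i j * v j l)"
      and span: "\<forall>j<d. \<forall>l<n. v j l = (\<Sum>i<k. ?ip (u i) (v j) * u i l)"
      by (elim exE conjE)
    note on = on[rule_format] and comb = comb[rule_format] and span = span[rule_format]
    \<comment> \<open>\<open>p\<close> is the projection of the next vector onto the current span
      and \<open>e\<close> the orthogonal remainder; the basis grows exactly when \<open>e\<close>
      is nonzero.\<close>
    define p where "p l = (\<Sum>i<k. ?ip (u i) (v d) * u i l)" for l
    define e where "e l = v d l - p l" for l
    have ip_sum: "?ip x (\<lambda>l. \<Sum>i<k. a i * u i l) = (\<Sum>i<k. a i * ?ip x (u i))" for x a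
    proof -
      have "?ip x (\<lambda>l. \<Sum>i<k. a i * u i l) = (\<Sum>l<n. \<Sum>i<k. a i * (x l * u i l))"
        by (simp add: sum_distrib_left mult_ac)
      also have "\<dots> = (\<Sum>i<k. a i * ?ip x (u i))"
        by (subst sum.swap) (simp add: sum_distrib_left)
      finally show ?thesis .
    qed
    have orth: "?ip (u i) e = 0" if "i < k" for i
    proof -
      have "?ip (u i) p = (\<Sum>j<k. ?ip (u j) (v d) * ?ip (u i) (u j))"
        unfolding p_def by (rule ip_sum)
      also have "\<dots> = (\<Sum>j<k. if i = j then ?ip (u j) (v d) else 0)"
        using that on by (intro sum.cong) auto
      also have "\<dots> = ?ip (u i) (v d)" using that by simp
      finally show ?thesis by (simp add: e_def right_diff_distrib sum_subtractf)
    qed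
    have orth': "?ip e (u i) = 0" if "i < k" for i
      using orth[OF that] by (simp add: mult.commute)
    show ?case
    proof (cases "\<forall>l<n. e l = 0")
      case True
      \<comment> \<open>The basis stays as it is, and a zero coefficient for the new vector extends
        the old combinations.\<close>
      define c' where "c' i = (c i)(d := 0)" for i
      have comb': "u i l = (\<Sum>j<Suc d. c' i j * v j l)" if "i < k" "l < n" for i l
        using comb[OF that] by (simp add: c'_def)
      have span': "v j l = (\<Sum>i<k. ?ip (u i) (v j) * u i l)" if "j < Suc d" "l < n" for j l
      proof (cases "j = d")
        case j: True
        have "v d l = p l" using True that(2) by (auto simp: e_def)
        then show ?thesis by (simp only: j p_def)
      next
        case False
        then have "j < d" using that by simp
        then show ?thesis using that(2) by (rule span)
      qed
      show ?thesis
      proof (rule exI[of _ k], rule exI[of _ u], rule exI[of _ c'], intro conjI allI impI)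
        show "k \<le> Suc d" using k by simp
        show "?ip (u i) (u j) = (if i = j then 1 else 0)" if "i < k" "j < k" for i j
          using that by (rule on)
        show "u i l = (\<Sum>j<Suc d. c' i j * v j l)" if "i < k" "l < n" for i l
          using that by (rule comb')
        show "v j l = (\<Sum>i<k. ?ip (u i) (v j) * u i l)" if "j < Suc d" "l < n" for j l
          using that by (rule span')
      qed
    next
      case False
      then obtain l0 where l0: "l0 < n" "e l0 \<noteq> 0" by auto
      define s where "s = sqrt (?ip e e)"
      have "?ip e e > 0" using l0 by (intro sum_pos2[of _ l0]) (auto simp: zero_less_mult_iff neq_iff)
      then have s: "s > 0" "s\<^sup>2 = ?ip e e" by (auto simp: s_def)
      define u' where "u' = u(k := \<lambda>l. e l / s)"
      \<comment> \<open>The last row expands \<open>e / s\<close>: the new vector enters with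
        \<open>1 / s\<close>, and the projection is rewritten through the earlier vectors.\<close>
      define c' where "c' = (\<lambda>i. (c i)(d := 0))(k := \<lambda>j. (if j = d then 1 else - (\<Sum>i<k. ?ip (u i) (v d) * c i j)) / s)"
      have scale: "?ip x (\<lambda>l. e l / s) = ?ip x e / s" "?ip (\<lambda>l. e l / s) x = ?ip e x / s" for x
        by (simp_all add: sum_divide_distrib)
      have on': "?ip (u' i) (u' j) = (if i = j then 1 else 0)" if "i < Suc k" "j < Suc k" for i j
      proof -
        have "?ip (\<lambda>l. e l / s) (\<lambda>l. e l / s) = 1"
          using s unfolding scale by (simp flip: s(2)) (simp add: power2_eq_square)
        then show ?thesis
          using that on orth orth' by (auto simp: u'_def less_Suc_eq simp flip: sum_divide_distrib)
      qed
      have comb': "u' i l = (\<Sum>j<Suc d. c' i j * v j l)" if "i < Suc k" "l < n" for i l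
      proof (cases "i = k")
        case True
        have "p l = (\<Sum>i<k. \<Sum>j<d. ?ip (u i) (v d) * c i j * v j l)"
          unfolding p_def
        proof (rule sum.cong[OF refl])
          fix i assume "i \<in> {..<k}"
          then have "u i l = (\<Sum>j<d. c i j * v j l)" using comb that by simp
          then show "?ip (u i) (v d) * u i l = (\<Sum>j<d. ?ip (u i) (v d) * c i j * v j l)"
            by (simp only: sum_distrib_left mult.assoc)
        qed
        also have "\<dots> = (\<Sum>j<d. (\<Sum>i<k. ?ip (u i) (v d) * c i j) * v j l)"
          by (subst sum.swap) (simp add: sum_distrib_right)
        finally have "e l / s = (v d l - (\<Sum>j<d. (\<Sum>i<k. ?ip (u i) (v d) * c i j) * v j l)) / s"
          by (simp add: e_def)
        then show ?thesis
          using True by (simp add: u'_def c'_def diff_divide_distrib sum_divide_distrib sum_negf)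
      next
        case False
        then show ?thesis using comb that by (simp add: u'_def c'_def)
      qed
      have span': "v j l = (\<Sum>i<Suc k. ?ip (u' i) (v j) * u' i l)" if "j < Suc d" "l < n" for j l
      proof (cases "j = d")
        case True
        have "?ip e p = 0" unfolding p_def by (subst ip_sum) (simp add: orth')
        then have "?ip e (v d) = s\<^sup>2"
          unfolding s(2) by (simp add: e_def right_diff_distrib sum_subtractf)
        moreover have "?ip (u' k) (v d) = ?ip e (v d) / s" by (simp add: u'_def sum_divide_distrib)
        ultimately have "?ip (u' k) (v d) = s" using s(1) by (simp add: power2_eq_square)
        then have "?ip (u' k) (v d) * u' k l = e l" using s(1) by (simp add: u'_def)
        moreover have "(\<Sum>i<k. ?ip (u' i) (v d) * u' i l) = p l" by (simp add: u'_def p_def)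
        ultimately show ?thesis using True by (simp add: e_def)
      next
        case False
        then have "j < d" using that by simp
        have "?ip e (v j) = ?ip e (\<lambda>l. \<Sum>i<k. ?ip (u i) (v j) * u i l)"
        proof (rule sum.cong[OF refl])
          fix l assume "l \<in> {..<n}"
          then have "v j l = (\<Sum>i<k. ?ip (u i) (v j) * u i l)" by (intro span[OF \<open>j < d\<close>]) simp
          then show "e l * v j l = e l * (\<Sum>i<k. ?ip (u i) (v j) * u i l)" by (rule arg_cong)
        qed
        also have "\<dots> = 0" by (subst ip_sum) (simp add: orth')
        finally have "?ip e (v j) = 0" .
        moreover have "?ip (u' k) (v j) = ?ip e (v j) / s" by (simp add: u'_def sum_divide_distrib)
        ultimately have "?ip (u' k) (v j) = 0" by simp
        moreover have "(\<Sum>i<k. ?ip (u' i) (v j) * u' i l) = v j l"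
        proof -
          have "(\<Sum>i<k. ?ip (u' i) (v j) * u' i l) = (\<Sum>i<k. ?ip (u i) (v j) * u i l)"
            by (rule sum.cong) (auto simp: u'_def)
          also have "\<dots> = v j l" by (rule span[OF \<open>j < d\<close> that(2), symmetric])
          finally show ?thesis .
        qed
        ultimately show ?thesis by simp
      qed
      show ?thesis
      proof (rule exI[of _ "Suc k"], rule exI[of _ u'], rule exI[of _ c'], intro conjI allI impI)
        show "Suc k \<le> Suc d" using k by simp
        show "?ip (u' i) (u' j) = (if i = j then 1 else 0)" if "i < Suc k" "j < Suc k" for i j
          using that by (rule on')
        show "u' i l = (\<Sum>j<Suc d. c' i j * v j l)" if "i < Suc k" "l < n" for i l
          using that by (rule comb')
        show "v j l = (\<Sum>i<Suc k. ?ip (u' i) (v j) * u' i l)" if "j < Suc d" "l < n" for j l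
          using that by (rule span')
      qed
    qed
  qed
  with that show ?thesis by blast
qed

text \<open>Let the columns of \<open>U\<close> be an orthonormal basis of the range of
  \<open>A\<close>, with \<open>U = A C\<close>. Then \<open>Y = C U^T\<close> gives
  \<open>A Y = U U^T\<close>, the orthogonal projection onto that range: it is symmetric and fixes
  the columns of \<open>A\<close>.\<close>

lemma least_squares_inverse_exists:
  fixes A :: "real mat"
  assumes A: "A \<in> carrier_mat n d"
  obtains Y where "Y \<in> carrier_mat d n" "(A * Y)\<^sup>T = A * Y" "A * Y * A = A"
proof -
  obtain k :: nat and u c :: "nat \<Rightarrow> nat \<Rightarrow> real" where "k \<le> d"
      and "\<And>i j. i < k \<Longrightarrow> j < k \<Longrightarrow> (\<Sum>l<n. u i l * u j l) = (if i = j then 1 else 0)"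
      and comb: "\<And>i l. i < k \<Longrightarrow> l < n \<Longrightarrow> u i l = (\<Sum>j<d. c i j * A $$ (l, j))"
    and span: "\<And>j l. j < d \<Longrightarrow> l < n \<Longrightarrow> A $$ (l, j) = (\<Sum>i<k. (\<Sum>l<n. u i l * A $$ (l, j)) * u i l)"
    by (rule gram_schmidt_exists[of d n "\<lambda>j l. A $$ (l, j)"]) blast
  define Y where "Y = mat d n (\<lambda>(j, l). \<Sum>i<k. c i j * u i l)"
  have Y: "Y \<in> carrier_mat d n" by (simp add: Y_def)
  have AY: "A * Y = mat n n (\<lambda>(l, l'). \<Sum>i<k. u i l * u i l')"
  proof (rule eq_matI)
    fix l l' assume "l < dim_row (mat n n (\<lambda>(l, l'). \<Sum>i<k. u i l * u i l'))"
      "l' < dim_col (mat n n (\<lambda>(l, l'). \<Sum>i<k. u i l * u i l'))"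
    then have l: "l < n" "l' < n" by auto
    then have "(A * Y) $$ (l, l') = (\<Sum>j<d. A $$ (l, j) * (\<Sum>i<k. c i j * u i l'))"
      using A by (simp add: Y_def scalar_prod_def atLeast0LessThan)
    also have "\<dots> = (\<Sum>i<k. \<Sum>j<d. A $$ (l, j) * (c i j * u i l'))"
      by (subst sum.swap) (simp add: sum_distrib_left)
    also have "\<dots> = (\<Sum>i<k. u i l * u i l')"
    proof (rule sum.cong[OF refl])
      fix i assume "i \<in> {..<k}"
      then have "u i l = (\<Sum>j<d. c i j * A $$ (l, j))" using comb l by simp
      then show "(\<Sum>j<d. A $$ (l, j) * (c i j * u i l')) = u i l * u i l'"
        by (simp only: sum_distrib_right) (simp only: mult_ac)
    qed
    finally show "(A * Y) $$ (l, l') = mat n n (\<lambda>(l, l'). \<Sum>i<k. u i l * u i l') $$ (l, l')"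
      using l by simp
  qed (use A in \<open>auto simp: Y_def\<close>)
  have "(A * Y)\<^sup>T = A * Y"
    unfolding AY by (rule eq_matI) (auto simp: mult.commute)
  moreover have "A * Y * A = A"
  proof (rule eq_matI)
    fix l j assume "l < dim_row A" "j < dim_col A"
    then have l: "l < n" "j < d" using A by auto
    then have "(A * Y * A) $$ (l, j) = (\<Sum>l'<n. (\<Sum>i<k. u i l * u i l') * A $$ (l', j))"
      unfolding AY using A by (simp add: scalar_prod_def atLeast0LessThan)
    also have "\<dots> = (\<Sum>i<k. \<Sum>l'<n. u i l * u i l' * A $$ (l', j))"
      by (subst sum.swap) (simp add: sum_distrib_right)
    also have "\<dots> = A $$ (l, j)"
    proof -
      have "(\<Sum>i<k. \<Sum>l'<n. u i l * u i l' * A $$ (l', j)) = (\<Sum>i<k. (\<Sum>l'<n. u i l' * A $$ (l', j)) * u i l)"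
        by (simp only: sum_distrib_right) (simp only: mult_ac)
      also have "\<dots> = A $$ (l, j)" by (rule span[OF l(2,1), symmetric])
      finally show ?thesis .
    qed
    finally show "(A * Y * A) $$ (l, j) = A $$ (l, j)" .
  qed (use A in \<open>auto simp: Y_def\<close>)
  ultimately show ?thesis using that Y by blast
qed

text \<open>\<open>Y\<close> makes \<open>M Y\<close> the symmetric projection onto the range of
  \<open>M\<close>. The same construction for the transpose, transposed back, gives \<open>W\<close>
  with \<open>W M\<close> symmetric. The product \<open>W M Y\<close> inherits both: multiplied by
  \<open>M\<close> on the left it gives \<open>M Y\<close>, on the right \<open>W M\<close>.\<close>

lemma pinv_exists: "\<exists>X. is_pinv (M :: real mat) X"
proof -
  define r c where "r = dim_row M" and "c = dim_col M"
  have M: "M \<in> carrier_mat r c" by (simp add: r_def c_def)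
  obtain Y where Y: "Y \<in> carrier_mat c r" "(M * Y)\<^sup>T = M * Y" "M * Y * M = M"
    using least_squares_inverse_exists[OF M] by blast
  obtain Z where Z: "Z \<in> carrier_mat r c" "(M\<^sup>T * Z)\<^sup>T = M\<^sup>T * Z" "M\<^sup>T * Z * M\<^sup>T = M\<^sup>T"
    using least_squares_inverse_exists[of "M\<^sup>T" c r] M by auto
  define W where "W = Z\<^sup>T"
  have W: "W \<in> carrier_mat c r" using Z by (simp add: W_def)
  have WM: "W * M = M\<^sup>T * Z"
    using Z(2) transpose_mult[of "M\<^sup>T" c r Z c] M Z(1) by (simp add: W_def)
  have "M * (W * M) = (M\<^sup>T * Z * M\<^sup>T)\<^sup>T"
    using transpose_mult[of "M\<^sup>T * Z" c c "M\<^sup>T" r] M Z(1,2) WM by simp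
  then have MWM: "M * (W * M) = M" using Z(3) by simp
  have MX: "M * (W * M * Y) = M * Y"
  proof -
    have "M * (W * M * Y) = M * (W * M) * Y"
      using M W Y(1) by (intro assoc_mult_mat[symmetric, of M r c "W * M" c Y r]) auto
    then show ?thesis by (simp only: MWM)
  qed
  have XM: "(W * M * Y) * M = W * M"
    using M W Y assoc_mult_mat[of W c r M c Y r] assoc_mult_mat[of W c r "M * Y" r M c] by simp
  have "is_pinv M (W * M * Y)"
    unfolding is_pinv_def
  proof (intro conjI)
    show "W * M * Y \<in> carrier_mat (dim_col M) (dim_row M)" using M W Y by simp
    show "M * (W * M * Y) * M = M" using MX Y by simp
    have "W * M * Y * M * (W * M * Y) = W * M * (W * M * Y)" using XM by simp
    also have "\<dots> = W * (M * (W * M * Y))"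
      using M W Y(1) by (intro assoc_mult_mat[of W c r M c _ r]) auto
    also have "\<dots> = W * (M * Y)" by (simp only: MX)
    also have "\<dots> = W * M * Y"
      using M W Y(1) by (intro assoc_mult_mat[symmetric, of W c r M c _ r]) auto
    finally show "W * M * Y * M * (W * M * Y) = W * M * Y" .
    show "(M * (W * M * Y))\<^sup>T = M * (W * M * Y)" using MX Y(2) by simp
    show "(W * M * Y * M)\<^sup>T = W * M * Y * M" using XM WM Z(2) by simp
  qed
  then show ?thesis by blast
qed

lemma is_pinv_pinv: "is_pinv (M :: real mat) (pinv M)"
  using pinv_exists pinv_eqI by metis

lemma smult_mat_mult_mat_vec:
  fixes C :: "real mat"
  assumes "C \<in> carrier_mat c r" "e \<in> carrier_vec r"
  shows "(k \<cdot>\<^sub>m C) *\<^sub>v e = k \<cdot>\<^sub>v (C *\<^sub>v e)"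
proof (rule eq_vecI)
  fix i assume "i < dim_vec (k \<cdot>\<^sub>v (C *\<^sub>v e))"
  then have "i < c" using assms by simp
  then have "row C i \<in> carrier_vec r" using assms by auto
  then show "((k \<cdot>\<^sub>m C) *\<^sub>v e) $ i = (k \<cdot>\<^sub>v (C *\<^sub>v e)) $ i"
    using assms \<open>i < c\<close> by simp
qed (use assms in simp)

section \<open>Normal equations and Tikhonov regularisation of a fixed matrix\<close>

context
  fixes M :: "real mat" and r c :: nat
  assumes M: "M \<in> carrier_mat r c"
begin

lemma pinv_carrier: "pinv M \<in> carrier_mat c r"
  using is_pinv_pinv[of M] M by (simp add: is_pinv_def)

lemma pinv_penrose:
  "M * pinv M * M = M" "pinv M * M * pinv M = pinv M"
  "(M * pinv M)\<^sup>T = M * pinv M" "(pinv M * M)\<^sup>T = pinv M * M"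
  using is_pinv_pinv[of M] by (auto simp: is_pinv_def)

lemma transpose_mult_mult_pinv: "M\<^sup>T * (M * pinv M) = M\<^sup>T"
proof -
  have "M\<^sup>T = (M * pinv M * M)\<^sup>T" by (simp only: pinv_penrose)
  also have "\<dots> = M\<^sup>T * (M * pinv M)\<^sup>T"
    using M pinv_carrier by (intro transpose_mult[of _ r r _ c]) auto
  finally show ?thesis by (simp only: pinv_penrose)
qed

lemma pinv_eq_transpose_mult: "pinv M = M\<^sup>T * ((pinv M)\<^sup>T * pinv M)"
proof -
  have "pinv M = (pinv M * M)\<^sup>T * pinv M" by (simp only: pinv_penrose)
  also have "(pinv M * M)\<^sup>T = M\<^sup>T * (pinv M)\<^sup>T"
    using M pinv_carrier by (intro transpose_mult[of _ c r _ c]) auto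
  also have "\<dots> * pinv M = M\<^sup>T * ((pinv M)\<^sup>T * pinv M)"
    using M pinv_carrier by (intro assoc_mult_mat[of _ c r _ c _ r]) auto
  finally show ?thesis .
qed

lemma normal_equation_pinv:
  assumes "e \<in> carrier_vec r"
  shows "M\<^sup>T *\<^sub>v (M *\<^sub>v (pinv M *\<^sub>v e)) = M\<^sup>T *\<^sub>v e"
proof -
  have "M\<^sup>T *\<^sub>v (M *\<^sub>v (pinv M *\<^sub>v e)) = (M\<^sup>T * (M * pinv M)) *\<^sub>v e"
    using assms M pinv_carrier by (simp add: assoc_mult_mat_vec[of _ c r _ r] assoc_mult_mat_vec[of _ r c _ r] del: assoc_mult_mat)
  then show ?thesis by (simp only: transpose_mult_mult_pinv)
qed

text \<open>This exhibits \<open>pinv M *\<^sub>v e\<close> as the image of an explicit vector under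
  the Gram matrix, the source condition that makes the regularisation error linear in
  \<open>t\<close>.\<close>

lemma gram_mult_pinv_source:
  assumes "e \<in> carrier_vec r"
  shows "M\<^sup>T *\<^sub>v (M *\<^sub>v (pinv M *\<^sub>v ((pinv M)\<^sup>T *\<^sub>v (pinv M *\<^sub>v e)))) = pinv M *\<^sub>v e"
proof -
  have "M\<^sup>T *\<^sub>v (M *\<^sub>v (pinv M *\<^sub>v ((pinv M)\<^sup>T *\<^sub>v (pinv M *\<^sub>v e)))) = M\<^sup>T *\<^sub>v ((pinv M)\<^sup>T *\<^sub>v (pinv M *\<^sub>v e))"
    using assms M pinv_carrier by (intro normal_equation_pinv) auto
  also have "\<dots> = (M\<^sup>T * ((pinv M)\<^sup>T * pinv M)) *\<^sub>v e"
    using assms M pinv_carrier by (simp add: assoc_mult_mat_vec[of _ c r _ r] assoc_mult_mat_vec[of _ r c _ r] del: assoc_mult_mat)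
  finally show ?thesis by (simp only: pinv_eq_transpose_mult[symmetric])
qed

lemma scalar_prod_gram:
  assumes "q \<in> carrier_vec c"
  shows "q \<bullet> (M\<^sup>T *\<^sub>v (M *\<^sub>v q)) = (euclid_norm (M *\<^sub>v q))\<^sup>2"
proof -
  have "(M\<^sup>T *\<^sub>v (M *\<^sub>v q)) \<bullet> q = (M *\<^sub>v q) \<bullet> (M *\<^sub>v q)"
    using M assms by (intro transpose_vec_mult_scalar) auto
  then show ?thesis
    using M assms by (simp add: euclid_norm_power2 comm_scalar_prod[of q c])
qed

text \<open>Let \<open>N\<close> be the Gram matrix, \<open>x\<close> the exact solution and
  \<open>y\<close> its source, so \<open>N y = x\<close>. The corrected error
  \<open>q = x - z - t y\<close> satisfies \<open>N q = - t q - t^2 y\<close>. Pairing with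
  \<open>q\<close>, where \<open>N\<close> is nonnegative, yields \<open>|q| \<le> t |y|\<close>;
  adding back \<open>t y\<close> gives the factor 2.\<close>

lemma tikhonov_error:
  assumes t: "t > 0" and e: "e \<in> carrier_vec r" and z: "z \<in> carrier_vec c"
    and eq: "M\<^sup>T *\<^sub>v (M *\<^sub>v z) + t \<cdot>\<^sub>v z = M\<^sup>T *\<^sub>v e"
  shows "euclid_norm (pinv M *\<^sub>v e - z) \<le> 2 * t * euclid_norm (pinv M *\<^sub>v ((pinv M)\<^sup>T *\<^sub>v (pinv M *\<^sub>v e)))"
proof -
  define x where "x = pinv M *\<^sub>v e"
  define y where "y = pinv M *\<^sub>v ((pinv M)\<^sup>T *\<^sub>v x)"
  define q where "q = x - z - t \<cdot>\<^sub>v y"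
  let ?N = "\<lambda>v. M\<^sup>T *\<^sub>v (M *\<^sub>v v)"
  have xyq: "x \<in> carrier_vec c" "y \<in> carrier_vec c" "q \<in> carrier_vec c"
    using pinv_carrier e z by (auto simp: x_def y_def q_def)
  have Nx: "?N x = ?N z + t \<cdot>\<^sub>v z" using normal_equation_pinv[OF e] eq by (simp add: x_def)
  have Ny: "?N y = x" using gram_mult_pinv_source[OF e] by (simp add: x_def y_def)
  have "?N q = ?N x - ?N z - t \<cdot>\<^sub>v ?N y"
  proof -
    have "M *\<^sub>v q = M *\<^sub>v x - M *\<^sub>v z - t \<cdot>\<^sub>v (M *\<^sub>v y)"
      unfolding q_def using M xyq z
      by (subst mult_minus_distrib_mat_vec[of _ r c], auto simp: mult_minus_distrib_mat_vec[of _ r c] mult_mat_vec[of _ r c])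
    then show ?thesis
      using M xyq z
      by (subst \<open>M *\<^sub>v q = _\<close>, subst mult_minus_distrib_mat_vec[of _ c r]) (auto simp: mult_minus_distrib_mat_vec[of _ c r] mult_mat_vec[of _ c r])
  qed
  then have Nq: "(?N q) $ i = - (t\<^sup>2 * y $ i) - t * q $ i" if "i < c" for i
    using that M xyq z by (simp add: Nx Ny q_def algebra_simps power2_eq_square)
  have "q \<bullet> ?N q = (\<Sum>i<c. - (t\<^sup>2 * (q $ i * y $ i)) - t * (q $ i * q $ i))"
  proof -
    have "q \<bullet> ?N q = (\<Sum>i<c. q $ i * (?N q) $ i)"
      using M xyq by (simp add: scalar_prod_def atLeast0LessThan)
    also have "\<dots> = (\<Sum>i<c. - (t\<^sup>2 * (q $ i * y $ i)) - t * (q $ i * q $ i))"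
      by (intro sum.cong) (auto simp: Nq algebra_simps)
    finally show ?thesis .
  qed
  also have "\<dots> = - t\<^sup>2 * (q \<bullet> y) - t * (euclid_norm q)\<^sup>2"
    unfolding euclid_norm_power2 scalar_prod_def using xyq
    by (simp add: atLeast0LessThan sum_subtractf sum_negf sum_distrib_left)
  finally have "t * (euclid_norm q)\<^sup>2 \<le> t\<^sup>2 * (- (q \<bullet> y))"
    using scalar_prod_gram[OF xyq(3)] zero_le_power2[of "euclid_norm (M *\<^sub>v q)"] by simp
  also have "\<dots> \<le> t\<^sup>2 * (euclid_norm q * euclid_norm y)"
    using abs_scalar_prod_le[OF xyq(3,2)] by (intro mult_left_mono) auto
  finally have "t * euclid_norm q * euclid_norm q \<le> t * euclid_norm q * (t * euclid_norm y)"
    by (simp add: power2_eq_square mult_ac)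
  then have nq: "euclid_norm q \<le> t * euclid_norm y"
    using t by (cases "euclid_norm q = 0") (auto simp: mult_le_cancel_left less_le)
  have "x - z = q + t \<cdot>\<^sub>v y" using xyq z by (intro eq_vecI) (auto simp: q_def)
  then have "euclid_norm (x - z) \<le> euclid_norm q + t * euclid_norm y"
    using euclid_norm_triangle[of q c "t \<cdot>\<^sub>v y"] xyq t by (simp add: euclid_norm_smult)
  then show ?thesis using nq by (simp add: x_def y_def)
qed

lemma pinv_mult_self:
  assumes inj: "\<And>x. x \<in> carrier_vec c \<Longrightarrow> M *\<^sub>v x = 0\<^sub>v r \<Longrightarrow> x = 0\<^sub>v c" and z: "z \<in> carrier_vec c"
  shows "pinv M *\<^sub>v (M *\<^sub>v z) = z"
proof -
  let ?x = "pinv M *\<^sub>v (M *\<^sub>v z)"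
  have x: "?x \<in> carrier_vec c" using pinv_carrier M z by auto
  have "M *\<^sub>v ?x = (M * pinv M * M) *\<^sub>v z"
    using M pinv_carrier z by (simp add: assoc_mult_mat_vec[of _ r r _ c] assoc_mult_mat_vec[of _ r c _ r] del: assoc_mult_mat)
  then have "M *\<^sub>v ?x = M *\<^sub>v z" by (simp only: pinv_penrose)
  then have "M *\<^sub>v (?x - z) = 0\<^sub>v r"
    using M x z by (subst mult_minus_distrib_mat_vec[of _ r c]) auto
  then have "?x - z = 0\<^sub>v c" using inj[of "?x - z"] x z by simp
  then have "?x $ i = z $ i" if "i < c" for i
    using that x z by (metis carrier_vecD index_minus_vec(1) index_zero_vec(1) eq_iff_diff_eq_0)
  then show ?thesis using x z pinv_carrier by (intro eq_vecI) auto
qed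

text \<open>This is \<open>(M^T M + t I)^(-1) M^T\<close> with the inverse written by Cramer's rule,
  so that its entries are visibly quotients of polynomials in the entries of
  \<open>M\<close>.\<close>

definition tikhonov :: "real \<Rightarrow> real mat" where
  "tikhonov t = (let B = M\<^sup>T * M + t \<cdot>\<^sub>m 1\<^sub>m c in (1 / det B) \<cdot>\<^sub>m (adj_mat B * M\<^sup>T))"

lemma tikhonov_solves:
  assumes t: "t > 0" and e: "e \<in> carrier_vec r"
  defines "z \<equiv> tikhonov t *\<^sub>v e"
  shows "z \<in> carrier_vec c" "M\<^sup>T *\<^sub>v (M *\<^sub>v z) + t \<cdot>\<^sub>v z = M\<^sup>T *\<^sub>v e"
proof -
  define B where "B = M\<^sup>T * M + t \<cdot>\<^sub>m 1\<^sub>m c"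
  have B: "B \<in> carrier_mat c c" using M by (simp add: B_def)
  have Bv: "B *\<^sub>v v = M\<^sup>T *\<^sub>v (M *\<^sub>v v) + t \<cdot>\<^sub>v v" if "v \<in> carrier_vec c" for v
  proof -
    have "(t \<cdot>\<^sub>m 1\<^sub>m c) *\<^sub>v v = t \<cdot>\<^sub>v v" using that by (intro eq_vecI) auto
    then show ?thesis unfolding B_def using that M by (subst add_mult_distrib_mat_vec[of _ c c]) auto
  qed
  \<comment> \<open>\<open>B\<close> is positive definite for \<open>t > 0\<close>: its quadratic
    form is at least \<open>t\<close> times the squared norm.\<close>
  have "det B \<noteq> 0"
  proof
    assume "det B = 0"
    then obtain v where v: "v \<in> carrier_vec c" "v \<noteq> 0\<^sub>v c" "B *\<^sub>v v = 0\<^sub>v c"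
      using det_0_iff_vec_prod_zero_field[OF B] by auto
    have "0 = v \<bullet> (B *\<^sub>v v)" using v by simp
    also have "\<dots> = (euclid_norm (M *\<^sub>v v))\<^sup>2 + t * (euclid_norm v)\<^sup>2"
      unfolding Bv[OF v(1)] using v(1) M
      by (subst scalar_prod_add_distrib[of _ c]) (auto simp: scalar_prod_gram euclid_norm_power2)
    finally have "t * (euclid_norm v)\<^sup>2 \<le> 0"
      using zero_le_power2[of "euclid_norm (M *\<^sub>v v)"] by linarith
    then have "euclid_norm v = 0" using t by (simp add: mult_le_0_iff)
    then show False using v by (simp add: euclid_norm_eq_0_iff)
  qed
  have adj: "adj_mat B \<in> carrier_mat c c" "B * adj_mat B = det B \<cdot>\<^sub>m 1\<^sub>m c" using adj_mat[OF B] by auto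
  have zeq: "z = (1 / det B) \<cdot>\<^sub>v (adj_mat B *\<^sub>v (M\<^sup>T *\<^sub>v e))"
  proof -
    have "z = (1 / det B) \<cdot>\<^sub>v ((adj_mat B * M\<^sup>T) *\<^sub>v e)"
      unfolding z_def tikhonov_def Let_def B_def[symmetric]
      using adj(1) M e by (intro smult_mat_mult_mat_vec[of _ c r]) auto
    also have "(adj_mat B * M\<^sup>T) *\<^sub>v e = adj_mat B *\<^sub>v (M\<^sup>T *\<^sub>v e)"
      using adj(1) M e by (intro assoc_mult_mat_vec[of _ c c _ r]) auto
    finally show ?thesis .
  qed
  show z: "z \<in> carrier_vec c" using adj M e unfolding zeq by auto
  have "B *\<^sub>v z = (1 / det B) \<cdot>\<^sub>v ((B * adj_mat B) *\<^sub>v (M\<^sup>T *\<^sub>v e))"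
  proof -
    have "B *\<^sub>v z = (1 / det B) \<cdot>\<^sub>v (B *\<^sub>v (adj_mat B *\<^sub>v (M\<^sup>T *\<^sub>v e)))"
      unfolding zeq using B adj(1) M e by (intro mult_mat_vec[of _ c c]) auto
    also have "B *\<^sub>v (adj_mat B *\<^sub>v (M\<^sup>T *\<^sub>v e)) = (B * adj_mat B) *\<^sub>v (M\<^sup>T *\<^sub>v e)"
      using B adj(1) M e by (intro assoc_mult_mat_vec[symmetric, of _ c c _ c]) auto
    finally show ?thesis .
  qed
  also have "\<dots> = M\<^sup>T *\<^sub>v e"
    unfolding adj(2) using M e \<open>det B \<noteq> 0\<close> by (intro eq_vecI) auto
  finally show "M\<^sup>T *\<^sub>v (M *\<^sub>v z) + t \<cdot>\<^sub>v z = M\<^sup>T *\<^sub>v e" using Bv[OF z] by simp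
qed

lemma tikhonov_carrier: "tikhonov t \<in> carrier_mat c r"
  using M by (auto simp: tikhonov_def Let_def adj_mat_def)

text \<open>The error bound is applied to the unit vector that selects column \<open>l\<close>; the
  source norm \<open>K\<close> is independent of \<open>t\<close>.\<close>

lemma tikhonov_tendsto_pinv:
  assumes "i < c" "l < r"
  shows "(\<lambda>k. tikhonov (1 / real (Suc k)) $$ (i, l)) \<longlonglongrightarrow> pinv M $$ (i, l)"
proof -
  let ?e = "unit_vec r l :: real vec" and ?t = "\<lambda>k. 1 / real (Suc k)"
  define K where "K = euclid_norm (pinv M *\<^sub>v ((pinv M)\<^sup>T *\<^sub>v (pinv M *\<^sub>v ?e)))"
  have entry: "(X *\<^sub>v ?e) $ i = X $$ (i, l)" if "X \<in> carrier_mat c r" for X :: "real mat"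
    using that assms by (simp add: row_def scalar_prod_right_unit)
  have "\<bar>pinv M $$ (i, l) - tikhonov (?t k) $$ (i, l)\<bar> \<le> 2 * ?t k * K" for k
  proof -
    have e: "?e \<in> carrier_vec r" by simp
    note sol = tikhonov_solves[OF _ e, of "?t k"]
    have "\<bar>(pinv M *\<^sub>v ?e - tikhonov (?t k) *\<^sub>v ?e) $ i\<bar> \<le> euclid_norm (pinv M *\<^sub>v ?e - tikhonov (?t k) *\<^sub>v ?e)"
      using assms tikhonov_carrier[of "?t k"] by (intro abs_index_le_euclid_norm) auto
    also have "\<dots> \<le> 2 * ?t k * K"
      unfolding K_def using sol by (intro tikhonov_error[OF _ e]) auto
    finally show ?thesis
      using assms tikhonov_carrier[of "?t k"] pinv_carrier entry by simp
  qed
  then have le: "norm (tikhonov (?t k) $$ (i, l) - pinv M $$ (i, l)) \<le> 2 * ?t k * K" for k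
    by (simp only: real_norm_def abs_minus_commute)
  have "(\<lambda>k. 2 * ?t k * K) \<longlonglongrightarrow> 2 * 0 * K"
    by (intro tendsto_intros LIMSEQ_Suc[OF lim_1_over_n])
  then have "(\<lambda>k. 2 * ?t k * K) \<longlonglongrightarrow> 0" by simp
  then have "(\<lambda>k. tikhonov (?t k) $$ (i, l) - pinv M $$ (i, l)) \<longlonglongrightarrow> 0"
    by (rule Lim_null_comparison[OF always_eventually[OF allI[OF le]]])
  then show ?thesis by (simp add: LIM_zero_iff)
qed

end

section \<open>Entrywise measurability of matrix-valued maps\<close>

definition borel_mat :: "'a measure \<Rightarrow> nat \<Rightarrow> nat \<Rightarrow> ('a \<Rightarrow> real mat) \<Rightarrow> bool" where
  "borel_mat N r c F \<longleftrightarrow> (\<forall>\<omega>. F \<omega> \<in> carrier_mat r c) \<and>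
     (\<forall>i<r. \<forall>j<c. (\<lambda>\<omega>. F \<omega> $$ (i, j)) \<in> borel_measurable N)"

lemma borel_mat_mult:
  assumes "borel_mat N r k F" "borel_mat N k c G"
  shows "borel_mat N r c (\<lambda>\<omega>. F \<omega> * G \<omega>)"
proof -
  have FG: "F \<omega> \<in> carrier_mat r k" "G \<omega> \<in> carrier_mat k c" for \<omega>
    using assms by (auto simp: borel_mat_def)
  then have "(F \<omega> * G \<omega>) $$ (i, j) = (\<Sum>l<k. F \<omega> $$ (i, l) * G \<omega> $$ (l, j))" if "i < r" "j < c" for i j \<omega>
    using that carrier_matD[OF FG(1)] carrier_matD[OF FG(2)] by (simp add: scalar_prod_def atLeast0LessThan)
  then show ?thesis
    using assms mult_carrier_mat[OF FG]
    by (auto simp: borel_mat_def intro!: borel_measurable_sum borel_measurable_times)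
qed

lemma borel_mat_transpose:
  assumes "borel_mat N r c F"
  shows "borel_mat N c r (\<lambda>\<omega>. (F \<omega>)\<^sup>T)"
proof -
  have F: "F \<omega> \<in> carrier_mat r c" for \<omega> using assms by (auto simp: borel_mat_def)
  then have "(F \<omega>)\<^sup>T $$ (i, j) = F \<omega> $$ (j, i)" if "i < c" "j < r" for i j \<omega>
    using that carrier_matD[OF F] by simp
  then show ?thesis using assms by (auto simp: borel_mat_def)
qed

lemma borel_measurable_det:
  assumes "borel_mat N n n F"
  shows "(\<lambda>\<omega>. det (F \<omega>)) \<in> borel_measurable N"
proof -
  have "det (F \<omega>) = (\<Sum>p\<in>{p. p permutes {0..<n}}. signof p * (\<Prod>i = 0..<n. F \<omega> $$ (i, p i)))" for \<omega>
    using assms by (intro det_def') (auto simp: borel_mat_def)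
  moreover have "(\<lambda>\<omega>. F \<omega> $$ (i, p i)) \<in> borel_measurable N" if "p permutes {0..<n}" "i < n" for p i
    using that assms permutes_in_image[of p "{0..<n}" i] by (auto simp: borel_mat_def)
  ultimately show ?thesis
    by (simp only:) (intro borel_measurable_sum borel_measurable_times borel_measurable_prod borel_measurable_const, auto)
qed

lemma borel_mat_adj:
  assumes "borel_mat N n n F"
  shows "borel_mat N n n (\<lambda>\<omega>. adj_mat (F \<omega>))"
proof -
  have F: "F \<omega> \<in> carrier_mat n n" for \<omega> using assms by (auto simp: borel_mat_def)
  have "borel_mat N (n - 1) (n - 1) (\<lambda>\<omega>. mat_delete (F \<omega>) j i)" if "i < n" "j < n" for i j
  proof -
    have "mat_delete (F \<omega>) j i $$ (i', j') = F \<omega> $$ (if i' < j then i' else Suc i', if j' < i then j' else Suc j')"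
      if "i' < n - 1" "j' < n - 1" for i' j' \<omega>
      using that F[of \<omega>] by (simp add: mat_delete_def)
    moreover have "(\<lambda>\<omega>. F \<omega> $$ (if i' < j then i' else Suc i', if j' < i then j' else Suc j')) \<in> borel_measurable N"
      if "i' < n - 1" "j' < n - 1" for i' j'
    proof -
      have "(if i' < j then i' else Suc i') < n" "(if j' < i then j' else Suc j') < n" using that by auto
      then show ?thesis using assms unfolding borel_mat_def by blast
    qed
    ultimately show ?thesis using mat_delete_carrier[OF F] by (auto simp: borel_mat_def)
  qed
  then have "(\<lambda>\<omega>. adj_mat (F \<omega>) $$ (i, j)) \<in> borel_measurable N" if "i < n" "j < n" for i j
  proof -
    have "adj_mat (F \<omega>) $$ (i, j) = (- 1) ^ (j + i) * det (mat_delete (F \<omega>) j i)" for \<omega>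
      using that F[of \<omega>] by (simp add: adj_mat_def cofactor_def)
    then show ?thesis
      using borel_measurable_det[OF \<open>\<And>i j. i < n \<Longrightarrow> j < n \<Longrightarrow> borel_mat N (n - 1) (n - 1) (\<lambda>\<omega>. mat_delete (F \<omega>) j i)\<close>] that
      by simp
  qed
  then show ?thesis using adj_mat(1)[OF F] by (auto simp: borel_mat_def)
qed

lemma borel_mat_pinv:
  assumes "borel_mat N r c F"
  shows "borel_mat N c r (\<lambda>\<omega>. pinv (F \<omega>))"
proof -
  have F: "F \<omega> \<in> carrier_mat r c" for \<omega> using assms by (auto simp: borel_mat_def)
  have tik: "(\<lambda>\<omega>. tikhonov (F \<omega>) c t $$ (i, l)) \<in> borel_measurable N" if "i < c" "l < r" for t i l
  proof -
    let ?B = "\<lambda>\<omega>. (F \<omega>)\<^sup>T * F \<omega> + t \<cdot>\<^sub>m 1\<^sub>m c"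
    have G: "borel_mat N c c (\<lambda>\<omega>. (F \<omega>)\<^sup>T * F \<omega>)"
      using assms by (intro borel_mat_mult[of _ _ r] borel_mat_transpose)
    have "(\<lambda>\<omega>. ?B \<omega> $$ (i, j)) \<in> borel_measurable N" if "i < c" "j < c" for i j
    proof -
      have "?B \<omega> $$ (i, j) = ((F \<omega>)\<^sup>T * F \<omega>) $$ (i, j) + t * (if i = j then 1 else 0)" for \<omega>
        using that F[of \<omega>] by simp
      moreover have "(\<lambda>\<omega>. ((F \<omega>)\<^sup>T * F \<omega>) $$ (i, j)) \<in> borel_measurable N"
        using G that by (simp add: borel_mat_def)
      ultimately show ?thesis by simp
    qed
    then have B: "borel_mat N c c ?B" using F by (simp add: borel_mat_def)
    have H: "borel_mat N c r (\<lambda>\<omega>. adj_mat (?B \<omega>) * (F \<omega>)\<^sup>T)"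
      using assms B by (intro borel_mat_mult[of _ _ c] borel_mat_adj borel_mat_transpose)
    have "tikhonov (F \<omega>) c t $$ (i, l) = 1 / det (?B \<omega>) * (adj_mat (?B \<omega>) * (F \<omega>)\<^sup>T) $$ (i, l)" for \<omega>
    proof -
      have "adj_mat (?B \<omega>) * (F \<omega>)\<^sup>T \<in> carrier_mat c r" using H by (simp add: borel_mat_def)
      from carrier_matD[OF this] show ?thesis
        using that F[of \<omega>] by (simp add: tikhonov_def Let_def)
    qed
    moreover have "(\<lambda>\<omega>. (adj_mat (?B \<omega>) * (F \<omega>)\<^sup>T) $$ (i, l)) \<in> borel_measurable N"
      using H that by (simp add: borel_mat_def)
    ultimately show ?thesis
      using borel_measurable_det[OF B] by simp
  qed
  have "(\<lambda>\<omega>. pinv (F \<omega>) $$ (i, l)) \<in> borel_measurable N" if "i < c" "l < r" for i l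
    by (rule borel_measurable_LIMSEQ_real[OF tikhonov_tendsto_pinv[OF F that] tik[OF that]])
  then show ?thesis using pinv_carrier[OF F] by (simp add: borel_mat_def)
qed

subsection \<open>Subspace embedding\<close>

text \<open>Only nonzero lattice vectors are assumed to be nearly preserved, because the
  probabilistic estimate concerns normalised vectors. At zero both bounds follow from the
  boundedness of the linear map.\<close>

lemma lower_bound_from_lattice:
  fixes T :: "nat \<Rightarrow> nat \<Rightarrow> real" and m :: nat
  assumes "d > 0" "k \<le> d"
  defines "h \<equiv> 1 / (10 * sqrt (real d))"
    and "F \<equiv> \<lambda>z. L2_set (\<lambda>i. \<Sum>l<k. T i l * z l) {..<m}"
  assumes isom: "\<And>q. q \<in> lattice_points k (100 * d) \<Longrightarrow> L2_set (\<lambda>l. h * real_of_int (q l)) {..<k} \<noteq> 0 \<Longrightarrow>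
      L2_set (\<lambda>l. h * real_of_int (q l)) {..<k} / 2 \<le> F (\<lambda>l. h * real_of_int (q l)) \<and>
      F (\<lambda>l. h * real_of_int (q l)) \<le> 2 * L2_set (\<lambda>l. h * real_of_int (q l)) {..<k}"
  shows "L2_set z {..<k} / 5 \<le> F z"
proof -
  let ?n = "\<lambda>x. L2_set x {..<k}"
  have bounded: "F x \<le> (\<Sum>i<m. ?n (T i)) * ?n x" for x
  proof -
    have "F x \<le> (\<Sum>i<m. \<bar>\<Sum>l<k. T i l * x l\<bar>)" unfolding F_def by (rule L2_set_le_sum_abs)
    also have "\<dots> \<le> (\<Sum>i<m. ?n (T i) * ?n x)"
    proof (rule sum_mono)
      fix i
      have "\<bar>\<Sum>l<k. T i l * x l\<bar> \<le> (\<Sum>l<k. \<bar>T i l\<bar> * \<bar>x l\<bar>)"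
        by (simp add: sum_abs flip: abs_mult)
      also have "\<dots> \<le> ?n (T i) * ?n x" by (rule L2_set_mult_ineq)
      finally show "\<bar>\<Sum>l<k. T i l * x l\<bar> \<le> ?n (T i) * ?n x" .
    qed
    finally show ?thesis by (simp only: sum_distrib_right)
  qed
  have zero: "F x = 0" if "?n x = 0" for x
    using bounded[of x] that L2_set_nonneg[of "\<lambda>i. \<Sum>l<k. T i l * x l" "{..<m}"] by (simp add: F_def)
  show ?thesis
  proof (rule seminorm_lower_bound_from_lattice[OF assms(1,2), where B="\<Sum>i<m. ?n (T i)", folded h_def])
    show "F (\<lambda>i. c * x i) = \<bar>c\<bar> * F x" for c x
    proof -
      have "(\<Sum>l<k. T i l * (c * x l)) = c * (\<Sum>l<k. T i l * x l)" for i
        by (simp add: sum_distrib_left mult_ac)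
      then show ?thesis
        by (simp add: F_def L2_set_def power_mult_distrib real_sqrt_mult flip: sum_distrib_left)
    qed
    show "F (\<lambda>i. x i + y i) \<le> F x + F y" for x y
      unfolding F_def by (simp add: distrib_left sum.distrib L2_set_triangle_ineq)
    show "F x \<le> (\<Sum>i<m. ?n (T i)) * ?n x" for x by (rule bounded)
    fix q assume q: "q \<in> lattice_points k (100 * d)"
    show "?n (\<lambda>l. h * real_of_int (q l)) / 2 \<le> F (\<lambda>l. h * real_of_int (q l))"
      using isom[OF q] zero[of "\<lambda>l. h * real_of_int (q l)"] by (cases "?n (\<lambda>l. h * real_of_int (q l)) = 0") auto
    show "F (\<lambda>l. h * real_of_int (q l)) \<le> 2 * ?n (\<lambda>l. h * real_of_int (q l))"
      using isom[OF q] zero[of "\<lambda>l. h * real_of_int (q l)"] by (cases "?n (\<lambda>l. h * real_of_int (q l)) = 0") auto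
  qed
qed

lemma sum_square_orthonormal:
  fixes u :: "nat \<Rightarrow> nat \<Rightarrow> real"
  assumes "\<And>i j. i < k \<Longrightarrow> j < k \<Longrightarrow> (\<Sum>l<n. u i l * u j l) = (if i = j then 1 else 0)"
  shows "(\<Sum>j<n. (\<Sum>l<k. u l j * z l)\<^sup>2) = (\<Sum>l<k. (z l)\<^sup>2)"
proof -
  have "(\<Sum>j<n. (\<Sum>l<k. u l j * z l)\<^sup>2) = (\<Sum>j<n. \<Sum>l<k. \<Sum>l'<k. z l * z l' * (u l j * u l' j))"
    by (simp add: power2_eq_square sum_product mult_ac)
  also have "\<dots> = (\<Sum>l<k. \<Sum>l'<k. z l * z l' * (\<Sum>j<n. u l j * u l' j))"
    by (subst sum.swap, rule sum.cong[OF refl], subst sum.swap) (simp only: sum_distrib_left)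
  also have "\<dots> = (\<Sum>l<k. \<Sum>l'<k. if l = l' then z l * z l' else 0)"
    by (intro sum.cong refl) (simp add: assms)
  also have "\<dots> = (\<Sum>l<k. (z l)\<^sup>2)"
    by (intro sum.cong refl) (simp add: power2_eq_square)
  finally show ?thesis .
qed

text \<open>The exceptional set is a finite union over nonzero lattice vectors, each with two
  Gaussian norm tails. Outside it the net argument is deterministic and yields the bound for all
  real \<open>z\<close> at once.\<close>

lemma gauss_matrix_lower_bound:
  fixes u :: "nat \<Rightarrow> nat \<Rightarrow> real"
  assumes "d > 0" "k \<le> d" "m > 0"
    and on: "\<And>i j. i < k \<Longrightarrow> j < k \<Longrightarrow> (\<Sum>l<n. u i l * u j l) = (if i = j then 1 else 0)"
  defines "Q \<equiv> gauss_matrix m n (sqrt (1 / real m))"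
  obtains N where "N \<in> sets Q" "measure Q N \<le> 2 * (2 ^ (100 * d) * 3 ^ d) * exp (- (real m / 4))"
    and "\<And>x z. x \<in> space Q - N \<Longrightarrow>
      L2_set z {..<k} / 5 \<le> L2_set (\<lambda>i. \<Sum>j<n. x (i, j) * (\<Sum>l<k. u l j * z l)) {..<m}"
proof -
  interpret prob_space Q unfolding Q_def using assms(3) by (intro prob_space_gauss_matrix) simp
  define h where "h = 1 / (10 * sqrt (real d))"
  define L where "L = {q \<in> lattice_points k (100 * d). L2_set (\<lambda>l. h * real_of_int (q l)) {..<k} \<noteq> 0}"
  define s where "s q = L2_set (\<lambda>l. h * real_of_int (q l)) {..<k}" for q :: "nat \<Rightarrow> int"
  \<comment> \<open>The lattice vector divided by its length is mapped into the ambient space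
    through the orthonormal family, which yields a unit vector.\<close>
  define y where "y q j = (\<Sum>l<k. u l j * (h * real_of_int (q l) / s q))" for q j
  define V where "V q x = (\<Sum>i<m. (\<Sum>j<n. x (i, j) * y q j)\<^sup>2)" for q and x :: "nat \<times> nat \<Rightarrow> real"
  define N where "N = (\<Union>q\<in>L. {x \<in> space Q. V q x \<ge> 4} \<union> {x \<in> space Q. V q x \<le> 1 / 4})"
  have fin: "finite L" unfolding L_def using finite_lattice_points by simp
  have [measurable]: "V q \<in> borel_measurable Q" for q
    unfolding V_def Q_def by (intro borel_measurable_sum borel_measurable_power gauss_matrix_row_measurable) auto
  have s: "s q > 0" if "q \<in> L" for q
    using that L2_set_nonneg[of "\<lambda>l. h * real_of_int (q l)" "{..<k}"] by (simp add: L_def s_def less_le)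
  have unit: "(\<Sum>j<n. (y q j)\<^sup>2) = 1" if "q \<in> L" for q
  proof -
    have "(\<Sum>j<n. (y q j)\<^sup>2) = (\<Sum>l<k. (h * real_of_int (q l) / s q)\<^sup>2)"
      unfolding y_def by (rule sum_square_orthonormal[OF on])
    also have "\<dots> = (\<Sum>l<k. (h * real_of_int (q l))\<^sup>2) / (s q)\<^sup>2"
      by (simp only: power_divide sum_divide_distrib)
    also have "(\<Sum>l<k. (h * real_of_int (q l))\<^sup>2) = (s q)\<^sup>2"
      by (simp add: s_def L2_set_def sum_nonneg)
    finally show ?thesis using s[OF that] by simp
  qed
  have meas: "{x \<in> space Q. V q x \<ge> 4} \<union> {x \<in> space Q. V q x \<le> 1 / 4} \<in> sets Q" for q by measurable
  have "N \<in> sets Q" unfolding N_def using fin meas by auto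
  moreover have "prob N \<le> 2 * (2 ^ (100 * d) * 3 ^ d) * exp (- (real m / 4))"
  proof -
    have "prob N \<le> (\<Sum>q\<in>L. prob ({x \<in> space Q. V q x \<ge> 4} \<union> {x \<in> space Q. V q x \<le> 1 / 4}))"
      unfolding N_def using fin meas by (intro finite_measure_subadditive_finite) auto
    also have "\<dots> \<le> (\<Sum>q\<in>L. 2 * exp (- (real m / 4)))"
    proof (rule sum_mono)
      fix q assume q: "q \<in> L"
      have "prob ({x \<in> space Q. V q x \<ge> 4} \<union> {x \<in> space Q. V q x \<le> 1 / 4})
          \<le> prob {x \<in> space Q. V q x \<ge> 4} + prob {x \<in> space Q. V q x \<le> 1 / 4}"
        by (intro measure_Un_le) measurable
      also have "\<dots> \<le> 2 * exp (- (real m / 4))"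
        using gauss_matrix_norm_tail[OF assms(3) unit[OF q]] by (simp add: V_def Q_def)
      finally show "prob ({x \<in> space Q. V q x \<ge> 4} \<union> {x \<in> space Q. V q x \<le> 1 / 4}) \<le> 2 * exp (- (real m / 4))" .
    qed
    also have "\<dots> = real (card L) * (2 * exp (- (real m / 4)))" by simp
    also have "\<dots> \<le> (2 ^ (100 * d) * 3 ^ d) * (2 * exp (- (real m / 4)))"
    proof (rule mult_right_mono)
      have "real (card L) \<le> real (card (lattice_points k (100 * d)))"
        unfolding L_def using finite_lattice_points by (intro of_nat_mono card_mono) auto
      also have "\<dots> \<le> 2 ^ (100 * d) * 3 ^ k" by (rule card_lattice_points_le)
      also have "\<dots> \<le> 2 ^ (100 * d) * 3 ^ d" using assms(2) by (intro mult_left_mono power_increasing) auto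
      finally show "real (card L) \<le> 2 ^ (100 * d) * 3 ^ d" .
    qed simp
    finally show ?thesis by simp
  qed
  moreover have "L2_set z {..<k} / 5 \<le> L2_set (\<lambda>i. \<Sum>j<n. x (i, j) * (\<Sum>l<k. u l j * z l)) {..<m}"
    if x: "x \<in> space Q - N" for x z
  proof -
    \<comment> \<open>\<open>T\<close> is the sketch in the coordinates of the orthonormal family,
      the linear map to which the net argument applies.\<close>
    define T where "T i l = (\<Sum>j<n. x (i, j) * u l j)" for i l
    have T: "(\<Sum>l<k. T i l * z l) = (\<Sum>j<n. x (i, j) * (\<Sum>l<k. u l j * z l))" for i z
    proof -
      have "(\<Sum>l<k. T i l * z l) = (\<Sum>l<k. \<Sum>j<n. x (i, j) * (u l j * z l))"
        by (simp add: T_def sum_distrib_right mult.assoc)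
      also have "\<dots> = (\<Sum>j<n. x (i, j) * (\<Sum>l<k. u l j * z l))"
        by (subst sum.swap) (simp only: sum_distrib_left)
      finally show ?thesis .
    qed
    have "L2_set z {..<k} / 5 \<le> L2_set (\<lambda>i. \<Sum>l<k. T i l * z l) {..<m}"
    proof (rule lower_bound_from_lattice[OF assms(1,2), folded h_def])
      fix q assume "q \<in> lattice_points k (100 * d)" "L2_set (\<lambda>l. h * real_of_int (q l)) {..<k} \<noteq> 0"
      then have q: "q \<in> L" by (simp add: L_def)
      have xy: "(\<Sum>j<n. x (i, j) * y q j) = (\<Sum>l<k. T i l * (h * real_of_int (q l))) / s q" for i
      proof -
        have "y q j = (\<Sum>l<k. u l j * (h * real_of_int (q l))) / s q" for j
          by (simp add: y_def sum_divide_distrib)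
        then show ?thesis
          unfolding T by (simp only: times_divide_eq_right sum_divide_distrib[of _ "{..<n}"])
      qed
      have "V q x = (\<Sum>i<m. (\<Sum>l<k. T i l * (h * real_of_int (q l)))\<^sup>2) / (s q)\<^sup>2"
        by (simp only: V_def xy power_divide sum_divide_distrib[of _ "{..<m}"])
      then have "V q x = (L2_set (\<lambda>i. \<Sum>l<k. T i l * (h * real_of_int (q l))) {..<m} / s q)\<^sup>2"
        by (simp add: L2_set_def power_divide sum_nonneg)
      moreover have "1 / 4 < V q x" "V q x < 4" using x q by (auto simp: N_def not_le)
      moreover define v where "v = L2_set (\<lambda>i. \<Sum>l<k. T i l * (h * real_of_int (q l))) {..<m} / s q"
      ultimately have "(1 / 2)\<^sup>2 \<le> v\<^sup>2" "v\<^sup>2 \<le> 2\<^sup>2" by (simp_all add: power_divide)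
      moreover have "v \<ge> 0" using s[OF q] by (simp add: v_def L2_set_nonneg)
      ultimately have "1 / 2 \<le> v" "v \<le> 2"
        by (auto intro: power2_le_imp_le)
      then show "L2_set (\<lambda>l. h * real_of_int (q l)) {..<k} / 2 \<le> L2_set (\<lambda>i. \<Sum>l<k. T i l * (h * real_of_int (q l))) {..<m} \<and>
          L2_set (\<lambda>i. \<Sum>l<k. T i l * (h * real_of_int (q l))) {..<m} \<le> 2 * L2_set (\<lambda>l. h * real_of_int (q l)) {..<k}"
        using s[OF q] unfolding s_def[symmetric] v_def by (simp add: field_simps)
    qed
    then show ?thesis by (simp only: T)
  qed
  ultimately show ?thesis using that by blast
qed

text \<open>Working in orthonormal coordinates of the range of \<open>A\<close> keeps the net in
  dimension at most \<open>d\<close>, so the failure probability does not involve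
  \<open>n\<close>.\<close>

lemma gauss_sketch_subspace_embedding:
  fixes A :: "real mat"
  assumes "d > 0" "m > 0" and A: "A \<in> carrier_mat n d"
  defines "Q \<equiv> gauss_matrix m n (sqrt (1 / real m))"
  obtains N where "N \<in> sets Q" "measure Q N \<le> 2 * (2 ^ (100 * d) * 3 ^ d) * exp (- (real m / 4))"
    and "\<And>x z. x \<in> space Q - N \<Longrightarrow> z \<in> carrier_vec d \<Longrightarrow>
      euclid_norm (A *\<^sub>v z) \<le> 5 * euclid_norm (mat m n x *\<^sub>v (A *\<^sub>v z))"
proof -
  obtain k :: nat and u c :: "nat \<Rightarrow> nat \<Rightarrow> real" where k: "k \<le> d"
      and on: "\<And>i j. i < k \<Longrightarrow> j < k \<Longrightarrow> (\<Sum>l<n. u i l * u j l) = (if i = j then 1 else 0)"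
      and "\<And>i l. i < k \<Longrightarrow> l < n \<Longrightarrow> u i l = (\<Sum>j<d. c i j * A $$ (l, j))"
      and span: "\<And>j l. j < d \<Longrightarrow> l < n \<Longrightarrow> A $$ (l, j) = (\<Sum>i<k. (\<Sum>l<n. u i l * A $$ (l, j)) * u i l)"
    by (rule gram_schmidt_exists[of d n "\<lambda>j l. A $$ (l, j)"]) blast
  obtain N where N: "N \<in> sets Q" "measure Q N \<le> 2 * (2 ^ (100 * d) * 3 ^ d) * exp (- (real m / 4))"
    and lower: "\<And>x z. x \<in> space Q - N \<Longrightarrow>
      L2_set z {..<k} / 5 \<le> L2_set (\<lambda>i. \<Sum>j<n. x (i, j) * (\<Sum>l<k. u l j * z l)) {..<m}"
    using gauss_matrix_lower_bound[OF assms(1) k assms(2) on] unfolding Q_def by blast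
  have "euclid_norm (A *\<^sub>v z) \<le> 5 * euclid_norm (mat m n x *\<^sub>v (A *\<^sub>v z))"
    if x: "x \<in> space Q - N" and z: "z \<in> carrier_vec d" for x z
  proof -
    define \<zeta> where "\<zeta> i = (\<Sum>j<d. (\<Sum>l<n. u i l * A $$ (l, j)) * z $ j)" for i
    have Az: "(A *\<^sub>v z) $ l = (\<Sum>i<k. u i l * \<zeta> i)" if l: "l < n" for l
    proof -
      have "(A *\<^sub>v z) $ l = (\<Sum>j<d. A $$ (l, j) * z $ j)"
        using A z l by (simp add: scalar_prod_def atLeast0LessThan)
      also have "\<dots> = (\<Sum>j<d. \<Sum>i<k. u i l * ((\<Sum>l<n. u i l * A $$ (l, j)) * z $ j))"
      proof (rule sum.cong[OF refl])
        fix j assume "j \<in> {..<d}"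
        then have "A $$ (l, j) = (\<Sum>i<k. (\<Sum>l<n. u i l * A $$ (l, j)) * u i l)" using l by (intro span) auto
        then have "A $$ (l, j) * z $ j = (\<Sum>i<k. (\<Sum>l<n. u i l * A $$ (l, j)) * u i l) * z $ j" by (rule arg_cong)
        also have "\<dots> = (\<Sum>i<k. u i l * ((\<Sum>l<n. u i l * A $$ (l, j)) * z $ j))"
          by (subst sum_distrib_right) (simp only: mult_ac)
        finally show "A $$ (l, j) * z $ j = (\<Sum>i<k. u i l * ((\<Sum>l<n. u i l * A $$ (l, j)) * z $ j))" .
      qed
      also have "\<dots> = (\<Sum>i<k. u i l * \<zeta> i)"
        unfolding \<zeta>_def by (subst sum.swap) (simp only: sum_distrib_left)
      finally show ?thesis .
    qed
    have dim: "dim_vec (A *\<^sub>v z) = n" using A by simp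
    have "euclid_norm (A *\<^sub>v z) = L2_set (\<lambda>l. \<Sum>i<k. u i l * \<zeta> i) {..<n}"
      unfolding euclid_norm_eq_L2_set dim using Az by (intro L2_set_cong) auto
    also have "\<dots> = L2_set \<zeta> {..<k}" by (simp add: L2_set_def sum_square_orthonormal[OF on])
    also have "\<dots> \<le> 5 * L2_set (\<lambda>i. \<Sum>j<n. x (i, j) * (\<Sum>l<k. u l j * \<zeta> l)) {..<m}"
      using lower[OF x, of \<zeta>] by simp
    also have "L2_set (\<lambda>i. \<Sum>j<n. x (i, j) * (\<Sum>l<k. u l j * \<zeta> l)) {..<m} = euclid_norm (mat m n x *\<^sub>v (A *\<^sub>v z))"
      unfolding euclid_norm_eq_L2_set
      using dim Az by (intro L2_set_cong) (auto simp: scalar_prod_def atLeast0LessThan intro!: sum.cong)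
    finally show ?thesis by simp
  qed
  with N that show ?thesis by blast
qed

subsection \<open>The sketched least-squares solution\<close>

lemma sketch_solution_error:
  fixes A S :: "real mat"
  assumes A: "A \<in> carrier_mat n d" and S: "S \<in> carrier_mat m n"
    and inj: "\<And>x. x \<in> carrier_vec d \<Longrightarrow> (S * A) *\<^sub>v x = 0\<^sub>v m \<Longrightarrow> x = 0\<^sub>v d"
    and a: "a \<in> carrier_vec d" and b: "b \<in> carrier_vec n" and x: "x \<in> carrier_vec d"
  shows "a \<bullet> (pinv (S * A) *\<^sub>v (S *\<^sub>v b)) - a \<bullet> x
    = ((pinv (S * A))\<^sup>T *\<^sub>v a) \<bullet> (S *\<^sub>v (b - A *\<^sub>v x))"
proof -
  have SA: "S * A \<in> carrier_mat m d" using A S by simp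
  note P = pinv_carrier[OF SA]
  let ?r = "b - A *\<^sub>v x"
  have r: "?r \<in> carrier_vec n" using A b x by auto
  have "S *\<^sub>v b = (S * A) *\<^sub>v x + S *\<^sub>v ?r"
  proof -
    have "b = A *\<^sub>v x + ?r" using A b x by (intro eq_vecI) auto
    then have "S *\<^sub>v b = S *\<^sub>v (A *\<^sub>v x + ?r)" by (rule arg_cong)
    also have "\<dots> = S *\<^sub>v (A *\<^sub>v x) + S *\<^sub>v ?r"
      using A S x r by (intro mult_add_distrib_mat_vec[of _ m n]) auto
    also have "S *\<^sub>v (A *\<^sub>v x) = (S * A) *\<^sub>v x"
      using A S x by (intro assoc_mult_mat_vec[symmetric]) auto
    finally show ?thesis .
  qed
  then have "pinv (S * A) *\<^sub>v (S *\<^sub>v b) = pinv (S * A) *\<^sub>v ((S * A) *\<^sub>v x) + pinv (S * A) *\<^sub>v (S *\<^sub>v ?r)"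
    using P SA S x r by (simp only:) (intro mult_add_distrib_mat_vec[of _ d m], auto)
  also have "pinv (S * A) *\<^sub>v ((S * A) *\<^sub>v x) = x"
    using inj x by (intro pinv_mult_self[OF SA]) auto
  finally have "a \<bullet> (pinv (S * A) *\<^sub>v (S *\<^sub>v b)) = a \<bullet> x + a \<bullet> (pinv (S * A) *\<^sub>v (S *\<^sub>v ?r))"
    using P S a x r by (simp only:) (intro scalar_prod_add_distrib[of _ d], auto)
  moreover have "((pinv (S * A))\<^sup>T *\<^sub>v a) \<bullet> (S *\<^sub>v ?r) = a \<bullet> (pinv (S * A) *\<^sub>v (S *\<^sub>v ?r))"
    using P S a r by (intro transpose_vec_mult_scalar[of _ d m]) auto
  ultimately show ?thesis by simp
qed

text \<open>With \<open>G = S A\<close> and \<open>z = pinv G w\<close>, the vector \<open>w\<close>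
  equals \<open>G z\<close>, so its squared norm is the inner product of \<open>a\<close> and
  \<open>z\<close>. Moreover \<open>z\<close> is recovered from \<open>A z\<close> by
  \<open>pinv A\<close>, and the embedding bounds \<open>|A z|\<close> by
  \<open>\<kappa> |G z| = \<kappa> |w|\<close>. Cancelling one factor \<open>|w|\<close> gives the
  claim.\<close>

lemma pinv_transpose_norm_le:
  fixes A S :: "real mat"
  assumes A: "A \<in> carrier_mat n d" and S: "S \<in> carrier_mat m n"
    and injA: "\<And>x. x \<in> carrier_vec d \<Longrightarrow> A *\<^sub>v x = 0\<^sub>v n \<Longrightarrow> x = 0\<^sub>v d"
    and inj: "\<And>x. x \<in> carrier_vec d \<Longrightarrow> (S * A) *\<^sub>v x = 0\<^sub>v m \<Longrightarrow> x = 0\<^sub>v d"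
    and a: "a \<in> carrier_vec d"
    and emb: "\<And>z. z \<in> carrier_vec d \<Longrightarrow> euclid_norm (A *\<^sub>v z) \<le> \<kappa> * euclid_norm ((S * A) *\<^sub>v z)"
    and \<kappa>: "\<kappa> \<ge> 0"
  shows "euclid_norm ((pinv (S * A))\<^sup>T *\<^sub>v a) \<le> \<kappa> * euclid_norm a * spectral_norm (pinv A)"
proof -
  define G where "G = S * A"
  have G: "G \<in> carrier_mat m d" using A S by (simp add: G_def)
  note P = pinv_carrier[OF G]
  define w where "w = (pinv G)\<^sup>T *\<^sub>v a"
  define z where "z = pinv G *\<^sub>v w"
  have w: "w \<in> carrier_vec m" and z: "z \<in> carrier_vec d" using P a by (auto simp: w_def z_def)
  have wG: "w = G *\<^sub>v z"
  proof -
    have "(pinv G)\<^sup>T = (pinv G * (G * pinv G))\<^sup>T"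
      using pinv_penrose(2)[OF G] P G assoc_mult_mat[of "pinv G" d m G d "pinv G" m] by simp
    also have "\<dots> = (G * pinv G)\<^sup>T * (pinv G)\<^sup>T"
      using P G by (intro transpose_mult[of _ d m _ m]) auto
    also have "\<dots> = G * pinv G * (pinv G)\<^sup>T" by (simp only: pinv_penrose[OF G])
    finally have "w = (G * pinv G * (pinv G)\<^sup>T) *\<^sub>v a" by (simp add: w_def)
    also have "\<dots> = (G * pinv G) *\<^sub>v w"
      unfolding w_def using P G a by (intro assoc_mult_mat_vec[of _ m m _ d]) auto
    also have "\<dots> = G *\<^sub>v z"
      unfolding z_def using P G w by (intro assoc_mult_mat_vec[of _ m d _ m]) auto
    finally show ?thesis .
  qed
  have "(euclid_norm w)\<^sup>2 = w \<bullet> (G *\<^sub>v z)" by (simp add: euclid_norm_power2 flip: wG)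
  also have "\<dots> = a \<bullet> (pinv G *\<^sub>v (G *\<^sub>v z))"
    unfolding w_def using P G a z by (intro transpose_vec_mult_scalar[of _ d m]) auto
  also have "pinv G *\<^sub>v (G *\<^sub>v z) = z"
    using inj z by (intro pinv_mult_self[OF G]) (auto simp: G_def)
  also have "a \<bullet> z \<le> euclid_norm a * euclid_norm z" using abs_scalar_prod_le[OF a z] by simp
  also have "euclid_norm z = euclid_norm (pinv A *\<^sub>v (A *\<^sub>v z))"
    using pinv_mult_self[OF A injA z] by simp
  also have "euclid_norm a * \<dots> \<le> euclid_norm a * (spectral_norm (pinv A) * euclid_norm (A *\<^sub>v z))"
    using pinv_carrier[OF A] A z by (intro mult_left_mono euclid_norm_mult_mat_vec_le[of _ d n]) auto
  also have "\<dots> \<le> euclid_norm a * (spectral_norm (pinv A) * (\<kappa> * euclid_norm w))"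
    using emb[OF z] spectral_norm_nonneg wG unfolding G_def[symmetric]
    by (intro mult_left_mono) auto
  finally have "euclid_norm w * euclid_norm w \<le> (\<kappa> * euclid_norm a * spectral_norm (pinv A)) * euclid_norm w"
    by (simp add: power2_eq_square mult_ac)
  moreover have "0 \<le> \<kappa> * euclid_norm a * spectral_norm (pinv A)"
    using \<kappa> spectral_norm_nonneg by (intro mult_nonneg_nonneg) auto
  ultimately have "euclid_norm w \<le> \<kappa> * euclid_norm a * spectral_norm (pinv A)"
    using euclid_norm_nonneg[of w] by (cases "euclid_norm w = 0") (auto simp: mult_le_cancel_right)
  then show ?thesis by (simp add: w_def G_def)
qed

section \<open>Gaussian tail of the error and its measurability\<close>

lemma borel_mat_gauss_matrix: "borel_mat (gauss_matrix m n \<sigma>) m n (mat m n)"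
proof -
  have "(\<lambda>x. x (i, j)) \<in> borel_measurable (gauss_matrix m n \<sigma>)" if "i < m" "j < n" for i j
    using that by (subst measurable_cong_sets[OF sets_gauss_matrix refl]) (auto intro!: measurable_component_singleton)
  then show ?thesis by (simp add: borel_mat_def)
qed

lemma borel_mat_const: "C \<in> carrier_mat r c \<Longrightarrow> borel_mat N r c (\<lambda>_. C)"
  by (simp add: borel_mat_def)

lemma borel_measurable_mult_mat_vec:
  assumes "borel_mat N r c F" "v \<in> carrier_vec c" "i < r"
  shows "(\<lambda>x. (F x *\<^sub>v v) $ i) \<in> borel_measurable N"
proof -
  have F: "F x \<in> carrier_mat r c" for x using assms(1) by (auto simp: borel_mat_def)
  have "(F x *\<^sub>v v) $ i = (\<Sum>j<c. F x $$ (i, j) * v $ j)" for x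
    using carrier_matD[OF F] assms(2,3) by (simp add: scalar_prod_def atLeast0LessThan)
  then show ?thesis
    using assms by (auto simp: borel_mat_def intro!: borel_measurable_sum borel_measurable_times)
qed

text \<open>Shifting the sketch along an outer product with the residual \<open>r\<close> does not change \<open>S * A\<close>, as
  \<open>r\<close> is orthogonal to the columns of \<open>A\<close>; so the weight vector is unchanged too.\<close>

lemma gauss_sketch_residual_tail:
  fixes A :: "real mat"
  assumes "m > 0" and A: "A \<in> carrier_mat n d" and a: "a \<in> carrier_vec d"
    and r: "r \<in> carrier_vec n" "A\<^sup>T *\<^sub>v r = 0\<^sub>v d"
    and L: "L > 0" and R: "euclid_norm r > 0" and \<tau>: "\<tau> > 0"
  defines "Q \<equiv> gauss_matrix m n (sqrt (1 / real m))"
    and "w \<equiv> \<lambda>x. (pinv (mat m n x * A))\<^sup>T *\<^sub>v a"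
  shows "{x \<in> space Q. euclid_norm (w x) \<le> L \<and> \<tau> \<le> \<bar>w x \<bullet> (mat m n x *\<^sub>v r)\<bar>} \<in> sets Q" (is "?B \<in> _")
    and "measure Q {x \<in> space Q. euclid_norm (w x) \<le> L \<and> \<tau> \<le> \<bar>w x \<bullet> (mat m n x *\<^sub>v r)\<bar>}
     \<le> 2 * exp (- (\<tau>\<^sup>2 * real m / (2 * (L * euclid_norm r)\<^sup>2)))"
proof -
  let ?\<sigma> = "sqrt (1 / real m)" and ?R = "euclid_norm r"
  have \<sigma>: "?\<sigma> > 0" using assms(1) by simp
  interpret prob_space Q unfolding Q_def using \<sigma> by (rule prob_space_gauss_matrix)
  have W: "borel_mat Q m d (\<lambda>x. (pinv (mat m n x * A))\<^sup>T)"
    unfolding Q_def using A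
    by (intro borel_mat_transpose borel_mat_pinv borel_mat_mult[of _ _ n] borel_mat_gauss_matrix borel_mat_const)
  have w_carrier: "w x \<in> carrier_vec m" for x
    unfolding w_def using W a by (intro mult_mat_vec_carrier[of _ m d]) (auto simp: borel_mat_def)
  have w_meas: "(\<lambda>x. w x $ i) \<in> borel_measurable Q" if "i < m" for i
    unfolding w_def using W a that by (rule borel_measurable_mult_mat_vec)
  have xr_meas: "(\<lambda>x. (mat m n x *\<^sub>v r) $ i) \<in> borel_measurable Q" if "i < m" for i
    unfolding Q_def using borel_mat_gauss_matrix r(1) that by (rule borel_measurable_mult_mat_vec)
  have D: "w x \<bullet> (mat m n x *\<^sub>v r) = (\<Sum>i<m. w x $ i * (mat m n x *\<^sub>v r) $ i)" for x
    using w_carrier[of x] by (simp add: scalar_prod_def atLeast0LessThan)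
  have nw: "(euclid_norm (w x))\<^sup>2 = (\<Sum>i<m. (w x $ i)\<^sup>2)" for x
    unfolding euclid_norm_power2
    using w_carrier[of x] by (simp add: scalar_prod_def atLeast0LessThan power2_eq_square)
  have nr: "?R\<^sup>2 = (\<Sum>j<n. (r $ j)\<^sup>2)"
    unfolding euclid_norm_power2
    using r(1) by (simp add: scalar_prod_def atLeast0LessThan power2_eq_square)
  have xr: "(mat m n x *\<^sub>v r) $ i = (\<Sum>j<n. x (i, j) * r $ j)" if "i < m" for x i
    using that r(1) by (simp add: scalar_prod_def atLeast0LessThan)
  have D_meas: "(\<lambda>x. w x \<bullet> (mat m n x *\<^sub>v r)) \<in> borel_measurable Q"
    unfolding D by (intro borel_measurable_sum borel_measurable_times w_meas xr_meas) auto
  have nw_meas: "(\<lambda>x. (euclid_norm (w x))\<^sup>2) \<in> borel_measurable Q"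
    unfolding nw by (intro borel_measurable_sum borel_measurable_power w_meas) auto
  have shift: "w (\<lambda>p\<in>{..<m} \<times> {..<n}. x p + \<mu> (fst p) * r $ snd p) = w x" for x \<mu>
  proof -
    let ?x' = "\<lambda>p\<in>{..<m} \<times> {..<n}. x p + \<mu> (fst p) * r $ snd p"
    have "mat m n ?x' * A = mat m n x * A"
    proof (rule eq_matI)
      fix i l assume "i < dim_row (mat m n x * A)" "l < dim_col (mat m n x * A)"
      then have il: "i < m" "l < d" using A by auto
      have "(A\<^sup>T *\<^sub>v r) $ l = (\<Sum>j<n. A $$ (j, l) * r $ j)"
        using A r(1) il by (simp add: scalar_prod_def atLeast0LessThan)
      then have zero: "(\<Sum>j<n. r $ j * A $$ (j, l)) = 0" using r(2) il by (simp add: mult.commute)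
      have "(mat m n ?x' * A) $$ (i, l) = (\<Sum>j<n. (x (i, j) + \<mu> i * r $ j) * A $$ (j, l))"
        using A il by (simp add: scalar_prod_def atLeast0LessThan)
      also have "\<dots> = (\<Sum>j<n. x (i, j) * A $$ (j, l)) + \<mu> i * (\<Sum>j<n. r $ j * A $$ (j, l))"
        by (simp add: distrib_right sum.distrib sum_distrib_left mult.assoc)
      also have "\<dots> = (mat m n x * A) $$ (i, l)"
        using A il zero by (simp add: scalar_prod_def atLeast0LessThan)
      finally show "(mat m n ?x' * A) $$ (i, l) = (mat m n x * A) $$ (i, l)" .
    qed (use A in auto)
    then show ?thesis by (simp only: w_def)
  qed
  let ?tail = "exp (- (\<tau>\<^sup>2 * real m / (2 * (L * ?R)\<^sup>2)))"
  have one_sided: "prob {x \<in> space Q. euclid_norm (w x) \<le> L \<and> \<tau> \<le> s * (w x \<bullet> (mat m n x *\<^sub>v r))} \<le> ?tail"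
    if s: "s = 1 \<or> s = - 1" for s :: real
  proof -
    \<comment> \<open>This choice maximises
      \<open>\<theta> \<tau> - \<theta>^2 L^2 |r|^2 / (2 m)\<close>, and the maximum is the exponent
      in the claim.\<close>
    define \<theta> where "\<theta> = \<tau> * real m / (L * ?R)\<^sup>2"
    have \<theta>: "\<theta> > 0" using assms(1) L R \<tau> by (simp add: \<theta>_def)
    \<comment> \<open>The compensator contains the actual norm of \<open>w x\<close>, so the
      exponential moment is bounded without restricting \<open>w\<close>; the bound \<open>L\<close>
      is inserted only on the event.\<close>
    define X where "X x = \<theta> * (s * (w x \<bullet> (mat m n x *\<^sub>v r))) - \<theta>\<^sup>2 / (2 * real m) * (euclid_norm (w x))\<^sup>2 * ?R\<^sup>2" for x
    have X_meas [measurable]: "X \<in> borel_measurable Q"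
      unfolding X_def by (intro borel_measurable_diff borel_measurable_times borel_measurable_const D_meas nw_meas)
    have "(\<integral>\<^sup>+x. ennreal (exp (X x)) \<partial>Q) \<le> 1"
    proof -
      have "X x = (\<Sum>i<m. \<theta> * s * w x $ i * (\<Sum>j<n. x (i, j) * r $ j))
          - ?\<sigma>\<^sup>2 / 2 * (\<Sum>i<m. (\<theta> * s * w x $ i)\<^sup>2) * (\<Sum>j<n. (r $ j)\<^sup>2)" for x
      proof -
        have "(\<Sum>i<m. \<theta> * s * w x $ i * (\<Sum>j<n. x (i, j) * r $ j)) = \<theta> * (s * (w x \<bullet> (mat m n x *\<^sub>v r)))"
        proof -
          have "(\<Sum>i<m. \<theta> * s * w x $ i * (\<Sum>j<n. x (i, j) * r $ j)) = (\<Sum>i<m. \<theta> * (s * (w x $ i * (mat m n x *\<^sub>v r) $ i)))"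
            using xr by (intro sum.cong refl) (simp only: lessThan_iff mult.assoc)
          then show ?thesis unfolding D by (simp only: sum_distrib_left)
        qed
        moreover have "(\<Sum>i<m. (\<theta> * s * w x $ i)\<^sup>2) = \<theta>\<^sup>2 * (euclid_norm (w x))\<^sup>2"
          unfolding nw sum_distrib_left using s by (intro sum.cong) (auto simp: power_mult_distrib)
        ultimately show ?thesis by (simp add: X_def nr)
      qed
      moreover have "(\<integral>\<^sup>+x. ennreal (exp ((\<Sum>i<m. \<theta> * s * w x $ i * (\<Sum>j<n. x (i, j) * r $ j))
          - ?\<sigma>\<^sup>2 / 2 * (\<Sum>i<m. (\<theta> * s * w x $ i)\<^sup>2) * (\<Sum>j<n. (r $ j)\<^sup>2))) \<partial>gauss_matrix m n ?\<sigma>) \<le> 1"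
      proof (rule gauss_exponential_supermartingale[OF \<sigma>, where w="\<lambda>x i. \<theta> * s * w x $ i"])
        show "(\<lambda>x. \<theta> * s * w x $ i) \<in> borel_measurable (PiM ({..<m} \<times> {..<n}) (\<lambda>_. borel))" if "i < m" for i
          using w_meas[OF that] unfolding Q_def measurable_cong_sets[OF sets_gauss_matrix refl]
          by (intro borel_measurable_times borel_measurable_const)
      qed (simp only: shift)
      ultimately show ?thesis by (simp only: Q_def)
    qed
    then have "prob {x \<in> space Q. X x \<ge> \<tau>\<^sup>2 * real m / (2 * (L * ?R)\<^sup>2)} \<le> 1 * ?tail"
      by (intro prob_ge_le_exp X_meas) auto
    moreover have "prob {x \<in> space Q. euclid_norm (w x) \<le> L \<and> \<tau> \<le> s * (w x \<bullet> (mat m n x *\<^sub>v r))}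
        \<le> prob {x \<in> space Q. X x \<ge> \<tau>\<^sup>2 * real m / (2 * (L * ?R)\<^sup>2)}"
    proof (rule finite_measure_mono)
      show "{x \<in> space Q. euclid_norm (w x) \<le> L \<and> \<tau> \<le> s * (w x \<bullet> (mat m n x *\<^sub>v r))}
          \<subseteq> {x \<in> space Q. X x \<ge> \<tau>\<^sup>2 * real m / (2 * (L * ?R)\<^sup>2)}"
      proof safe
        fix x assume le: "euclid_norm (w x) \<le> L" and ge: "\<tau> \<le> s * (w x \<bullet> (mat m n x *\<^sub>v r))"
        have "(euclid_norm (w x))\<^sup>2 \<le> L\<^sup>2" using le by (intro power_mono) auto
        then have "\<theta>\<^sup>2 / (2 * real m) * (euclid_norm (w x))\<^sup>2 * ?R\<^sup>2 \<le> \<theta>\<^sup>2 / (2 * real m) * L\<^sup>2 * ?R\<^sup>2"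
          by (intro mult_right_mono mult_left_mono) auto
        moreover have "\<theta> * \<tau> \<le> \<theta> * (s * (w x \<bullet> (mat m n x *\<^sub>v r)))"
          using ge \<theta> by (intro mult_left_mono) auto
        moreover have "\<theta> * \<tau> - \<theta>\<^sup>2 / (2 * real m) * L\<^sup>2 * ?R\<^sup>2 = \<tau>\<^sup>2 * real m / (2 * (L * ?R)\<^sup>2)"
          using assms(1) L R by (simp add: \<theta>_def power2_eq_square field_simps)
        ultimately show "X x \<ge> \<tau>\<^sup>2 * real m / (2 * (L * ?R)\<^sup>2)" unfolding X_def by linarith
      qed
    qed measurable
    ultimately show ?thesis by simp
  qed
  \<comment> \<open>Squaring, an equivalence because \<open>L > 0\<close>, replaces the norm by a
    finite sum of squares whose measurability is already known.\<close>
  have nw_set: "{x \<in> space Q. euclid_norm (w x) \<le> L \<and> P x} = {x \<in> space Q. (euclid_norm (w x))\<^sup>2 \<le> L\<^sup>2 \<and> P x}" for P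
    using L by (auto simp: power_mono intro: power2_le_imp_le)
  have event: "{x \<in> space Q. euclid_norm (w x) \<le> L \<and> \<tau> \<le> s * (w x \<bullet> (mat m n x *\<^sub>v r))} \<in> sets Q" for s
  proof -
    note [measurable] = D_meas nw_meas
    show ?thesis unfolding nw_set by measurable
  qed
  let ?E = "\<lambda>s. {x \<in> space Q. euclid_norm (w x) \<le> L \<and> \<tau> \<le> s * (w x \<bullet> (mat m n x *\<^sub>v r))}"
  have split: "{x \<in> space Q. euclid_norm (w x) \<le> L \<and> \<tau> \<le> \<bar>w x \<bullet> (mat m n x *\<^sub>v r)\<bar>} = ?E 1 \<union> ?E (- 1)"
    using \<tau> by (auto simp: abs_if)
  have "prob (?E 1 \<union> ?E (- 1)) \<le> prob (?E 1) + prob (?E (- 1))"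
    by (rule measure_Un_le[OF event[of 1] event[of "- 1"]])
  also have "\<dots> \<le> ?tail + ?tail"
    by (rule add_mono[OF one_sided[OF disjI1[OF refl]] one_sided[OF disjI2[OF refl]]])
  finally show "measure Q ?B \<le> 2 * ?tail" unfolding split by (simp only: mult_2)
  show "?B \<in> sets Q" unfolding split by (intro sets.Un event)
qed

lemma borel_measurable_sketch_solution:
  fixes A :: "real mat"
  assumes A: "A \<in> carrier_mat n d" and a: "a \<in> carrier_vec d" and b: "b \<in> carrier_vec n"
  shows "(\<lambda>x. a \<bullet> (pinv (mat m n x * A) *\<^sub>v (mat m n x *\<^sub>v b))) \<in> borel_measurable (gauss_matrix m n \<sigma>)"
proof -
  let ?Q = "gauss_matrix m n \<sigma>"
  have P: "borel_mat ?Q d m (\<lambda>x. pinv (mat m n x * A))"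
    using A by (intro borel_mat_pinv borel_mat_mult[of _ _ n] borel_mat_gauss_matrix borel_mat_const)
  then have PS: "borel_mat ?Q d n (\<lambda>x. pinv (mat m n x * A) * mat m n x)"
    by (intro borel_mat_mult[of _ _ m] borel_mat_gauss_matrix)
  have Pc: "pinv (mat m n x * A) \<in> carrier_mat d m" for x using P by (auto simp: borel_mat_def)
  have "pinv (mat m n x * A) *\<^sub>v (mat m n x *\<^sub>v b) = (pinv (mat m n x * A) * mat m n x) *\<^sub>v b" for x
    using Pc b by (intro assoc_mult_mat_vec[symmetric, of _ d m _ n]) auto
  moreover have "a \<bullet> ((pinv (mat m n x * A) * mat m n x) *\<^sub>v b)
      = (\<Sum>l<d. a $ l * ((pinv (mat m n x * A) * mat m n x) *\<^sub>v b) $ l)" for x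
    using carrier_matD[OF Pc] by (simp add: scalar_prod_def atLeast0LessThan)
  moreover have "(\<lambda>x. \<Sum>l<d. a $ l * ((pinv (mat m n x * A) * mat m n x) *\<^sub>v b) $ l) \<in> borel_measurable ?Q"
    using borel_measurable_mult_mat_vec[OF PS b]
    by (intro borel_measurable_sum borel_measurable_times borel_measurable_const) auto
  ultimately show ?thesis by (simp only:)
qed

text \<open>Failure has two sources, one for each exponential term: the embedding may break down, or
  the Gaussian error may be too large although \<open>w\<close> is bounded. The parameter
  \<open>t\<close> is the squared deviation in units of the largest conditional variance that the
  bound on \<open>w\<close> permits.\<close>

lemma gauss_sketch_error_prob:
  fixes A :: "real mat"
  assumes "d > 0" "m > 0" "t > 0" and A: "A \<in> carrier_mat n d"
    and injA: "\<And>x. x \<in> carrier_vec d \<Longrightarrow> A *\<^sub>v x = 0\<^sub>v n \<Longrightarrow> x = 0\<^sub>v d"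
    and a: "a \<in> carrier_vec d" and b: "b \<in> carrier_vec n"
  defines "Q \<equiv> gauss_matrix m n (sqrt (1 / real m))" and "xs \<equiv> pinv A *\<^sub>v b"
  assumes \<tau>: "\<tau> \<ge> sqrt (t / real m) * (5 * euclid_norm a * spectral_norm (pinv A) * euclid_norm (b - A *\<^sub>v xs))"
  defines "E \<equiv> {x \<in> space Q. \<bar>a \<bullet> (pinv (mat m n x * A) *\<^sub>v (mat m n x *\<^sub>v b)) - a \<bullet> xs\<bar> \<le> \<tau>}"
  shows "E \<in> sets Q"
    and "measure Q E \<ge> 1 - (2 * (2 ^ (100 * d) * 3 ^ d) * exp (- (real m / 4)) + 2 * exp (- t / 2))"
proof -
  interpret prob_space Q unfolding Q_def using assms(2) by (intro prob_space_gauss_matrix) simp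
  define r where "r = b - A *\<^sub>v xs"
  define L where "L = 5 * euclid_norm a * spectral_norm (pinv A)"
  define w where "w = (\<lambda>x. (pinv (mat m n x * A))\<^sup>T *\<^sub>v a)"
  have xs: "xs \<in> carrier_vec d" using pinv_carrier[OF A] b by (simp add: xs_def)
  have r: "r \<in> carrier_vec n" using A b xs by (simp add: r_def)
  have r_orth: "A\<^sup>T *\<^sub>v r = 0\<^sub>v d"
  proof -
    have "A\<^sup>T *\<^sub>v r = A\<^sup>T *\<^sub>v b - A\<^sup>T *\<^sub>v (A *\<^sub>v xs)"
      unfolding r_def using A b xs by (intro mult_minus_distrib_mat_vec[of _ d n]) auto
    also have "A\<^sup>T *\<^sub>v (A *\<^sub>v xs) = A\<^sup>T *\<^sub>v b"
      unfolding xs_def using normal_equation_pinv[OF A b] .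
    finally show ?thesis using A b by simp
  qed
  have err_meas [measurable]: "(\<lambda>x. a \<bullet> (pinv (mat m n x * A) *\<^sub>v (mat m n x *\<^sub>v b))) \<in> borel_measurable Q"
    unfolding Q_def by (rule borel_measurable_sketch_solution[OF A a b])
  show E: "E \<in> sets Q" unfolding E_def by measurable
  obtain N where N: "N \<in> sets Q" "prob N \<le> 2 * (2 ^ (100 * d) * 3 ^ d) * exp (- (real m / 4))"
    and emb: "\<And>x z. x \<in> space Q - N \<Longrightarrow> z \<in> carrier_vec d \<Longrightarrow>
      euclid_norm (A *\<^sub>v z) \<le> 5 * euclid_norm (mat m n x *\<^sub>v (A *\<^sub>v z))"
    using gauss_sketch_subspace_embedding[OF assms(1,2) A] unfolding Q_def by blast
  have good: "a \<bullet> (pinv (mat m n x * A) *\<^sub>v (mat m n x *\<^sub>v b)) - a \<bullet> xs = w x \<bullet> (mat m n x *\<^sub>v r)"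
      "euclid_norm (w x) \<le> L" if x: "x \<in> space Q - N" for x
  proof -
    have S: "mat m n x \<in> carrier_mat m n" by simp
    have assoc: "(mat m n x * A) *\<^sub>v z = mat m n x *\<^sub>v (A *\<^sub>v z)" if "z \<in> carrier_vec d" for z
      using A that by (intro assoc_mult_mat_vec[of _ m n _ d]) auto
    have inj: "z = 0\<^sub>v d" if z: "z \<in> carrier_vec d" "(mat m n x * A) *\<^sub>v z = 0\<^sub>v m" for z
    proof -
      have "euclid_norm (A *\<^sub>v z) \<le> 0" using emb[OF x z(1)] z(2) assoc[OF z(1)] by simp
      then have "euclid_norm (A *\<^sub>v z) = 0" using euclid_norm_nonneg[of "A *\<^sub>v z"] by linarith
      then have "A *\<^sub>v z = 0\<^sub>v n" using A z(1) euclid_norm_eq_0_iff[of "A *\<^sub>v z" n] by simp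
      then show ?thesis using injA z(1) by blast
    qed
    show "a \<bullet> (pinv (mat m n x * A) *\<^sub>v (mat m n x *\<^sub>v b)) - a \<bullet> xs = w x \<bullet> (mat m n x *\<^sub>v r)"
      unfolding w_def r_def using inj by (intro sketch_solution_error[OF A S _ a b xs]) auto
    show "euclid_norm (w x) \<le> L"
      unfolding w_def L_def
      using injA inj emb[OF x] assoc by (intro pinv_transpose_norm_le[OF A S _ _ a]) auto
  qed
  have L0: "L \<ge> 0" unfolding L_def using spectral_norm_nonneg by simp
  have le: "sqrt (t / real m) * (L * euclid_norm r) \<le> \<tau>" using \<tau> by (simp add: L_def r_def)
  \<comment> \<open>The tail bound divides by \<open>L |r|\<close>. When this product vanishes, so
    does the error off \<open>N\<close>, and no further exceptional set is needed.\<close>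
  obtain D where D: "D \<in> sets Q" "prob D \<le> 2 * exp (- t / 2)" and sub: "space Q - (N \<union> D) \<subseteq> E"
  proof (cases "L * euclid_norm r = 0")
    case True
    have "\<tau> \<ge> 0" using le True by simp
    have "x \<in> E" if x: "x \<in> space Q - N" for x
    proof -
      have "pinv (mat m n x * A) \<in> carrier_mat d m" using A by (intro pinv_carrier mult_carrier_mat[of _ m n]) simp_all
      then have "w x \<in> carrier_vec m"
        unfolding w_def using a by (intro mult_mat_vec_carrier[of _ m d]) simp_all
      moreover have "mat m n x *\<^sub>v r \<in> carrier_vec m"
        using r by (intro mult_mat_vec_carrier[of _ m n]) simp_all
      ultimately have "\<bar>w x \<bullet> (mat m n x *\<^sub>v r)\<bar> \<le> euclid_norm (w x) * euclid_norm (mat m n x *\<^sub>v r)"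
        by (rule abs_scalar_prod_le)
      also have "\<dots> = 0"
      proof (cases "L = 0")
        case True
        then show ?thesis using good(2)[OF x] euclid_norm_nonneg[of "w x"] by simp
      next
        case False
        then have "r = 0\<^sub>v n" using \<open>L * euclid_norm r = 0\<close> r by (simp add: euclid_norm_eq_0_iff)
        then have "mat m n x *\<^sub>v r = 0\<^sub>v m" by auto
        then show ?thesis by simp
      qed
      finally show ?thesis using good(1)[OF x] x \<open>\<tau> \<ge> 0\<close> by (simp add: E_def)
    qed
    then show ?thesis by (intro that[of "{}"]) auto
  next
    case False
    then have L: "L > 0" and R: "euclid_norm r > 0"
      using L0 euclid_norm_nonneg[of r] by (auto simp: less_le)
    \<comment> \<open>The tail is taken at the exact threshold, where the exponent is
      \<open>t / 2\<close>; the given \<open>\<tau>\<close> is at least as large.\<close>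
    define s where "s = sqrt (t / real m) * (L * euclid_norm r)"
    have s: "s > 0" using assms(2,3) L R by (simp add: s_def)
    define B where "B = {x \<in> space Q. euclid_norm (w x) \<le> L \<and> s \<le> \<bar>w x \<bullet> (mat m n x *\<^sub>v r)\<bar>}"
    have "B \<in> sets Q" "prob B \<le> 2 * exp (- (s\<^sup>2 * real m / (2 * (L * euclid_norm r)\<^sup>2)))"
      unfolding B_def w_def Q_def by (rule gauss_sketch_residual_tail[OF assms(2) A a r r_orth L R s])+
    moreover have "s\<^sup>2 * real m / (2 * (L * euclid_norm r)\<^sup>2) = t / 2"
      using assms(2,3) L R by (simp add: s_def power_mult_distrib)
    moreover have "space Q - (N \<union> B) \<subseteq> E"
    proof
      fix x assume x: "x \<in> space Q - (N \<union> B)"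
      then have "\<bar>w x \<bullet> (mat m n x *\<^sub>v r)\<bar> < s" using good(2)[of x] by (auto simp: B_def)
      then show "x \<in> E" using good(1)[of x] x le by (simp add: E_def s_def)
    qed
    ultimately show ?thesis by (intro that[of B]) auto
  qed
  have "1 - prob (N \<union> D) = prob (space Q - (N \<union> D))" using N D by (simp add: prob_compl)
  also have "\<dots> \<le> prob E" using sub E by (rule finite_measure_mono)
  finally show "prob E \<ge> 1 - (2 * (2 ^ (100 * d) * 3 ^ d) * exp (- (real m / 4)) + 2 * exp (- t / 2))"
    using measure_Un_le[OF N(1) D(1)] N(2) D(2) by linarith
qed

section \<open>Transfer to an arbitrary probability space and choice of constants\<close>

lemma gaussian_sketch_distr:
  assumes sketch: "gaussian_sketch M m n S" and "m > 0" "n > 0"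
  defines "X \<equiv> \<lambda>\<omega>. \<lambda>p\<in>{..<m} \<times> {..<n}. S \<omega> $$ p"
  shows "X \<in> measurable M (gauss_matrix m n (sqrt (1 / real m)))"
    and "distr M (gauss_matrix m n (sqrt (1 / real m))) X = gauss_matrix m n (sqrt (1 / real m))"
    and "\<omega> \<in> space M \<Longrightarrow> mat m n (X \<omega>) = S \<omega>"
proof -
  let ?I = "{..<m} \<times> {..<n}" and ?\<sigma> = "sqrt (1 / real m)"
  interpret prob_space M using sketch by (simp add: gaussian_sketch_def)
  have rv: "(\<lambda>\<omega>. S \<omega> $$ p) \<in> borel_measurable M"
    and law: "distr M borel (\<lambda>\<omega>. S \<omega> $$ p) = gauss_measure 0 ?\<sigma>" if "p \<in> ?I" for p
  proof -
    have dist: "distributed M lborel (\<lambda>\<omega>. S \<omega> $$ p) (normal_density 0 ?\<sigma>)"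
      using sketch that by (auto simp: gaussian_sketch_def)
    then show "(\<lambda>\<omega>. S \<omega> $$ p) \<in> borel_measurable M" by (auto dest: distributed_measurable)
    have "distr M borel (\<lambda>\<omega>. S \<omega> $$ p) = distr M lborel (\<lambda>\<omega>. S \<omega> $$ p)" by (rule distr_cong) auto
    also have "\<dots> = gauss_measure 0 ?\<sigma>" using dist by (simp add: distributed_def gauss_measure_def)
    finally show "distr M borel (\<lambda>\<omega>. S \<omega> $$ p) = gauss_measure 0 ?\<sigma>" .
  qed
  have X: "X \<in> measurable M (PiM ?I (\<lambda>_. borel))"
    unfolding X_def using rv by (intro measurable_restrict) auto
  then show "X \<in> measurable M (gauss_matrix m n ?\<sigma>)"
    by (simp cong: measurable_cong_sets)
  \<comment> \<open>Independence together with the marginal laws determines the joint law, which is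
    therefore the canonical product measure.\<close>
  have "indep_vars (\<lambda>_. borel) (\<lambda>p \<omega>. S \<omega> $$ p) ?I"
    using sketch by (simp add: gaussian_sketch_def case_prod_beta')
  then have "distr M (PiM ?I (\<lambda>_. borel)) X = PiM ?I (\<lambda>p. distr M borel (\<lambda>\<omega>. S \<omega> $$ p))"
    unfolding X_def using assms(2,3) rv by (subst (asm) indep_vars_iff_distr_eq_PiM') auto
  also have "\<dots> = gauss_matrix m n ?\<sigma>"
    unfolding gauss_matrix_def using law by (intro PiM_cong) auto
  finally show "distr M (gauss_matrix m n ?\<sigma>) X = gauss_matrix m n ?\<sigma>"
    using distr_cong[OF refl sets_gauss_matrix, of M X X] by simp
  assume "\<omega> \<in> space M"
  then have "S \<omega> \<in> carrier_mat m n" using sketch by (simp add: gaussian_sketch_def)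
  then show "mat m n (X \<omega>) = S \<omega>" by (intro eq_matI) (auto simp: X_def)
qed

text \<open>The net size is at most \<open>exp (92 d)\<close>: 90 from
  \<open>2 \<le> exp (9 / 10)\<close> to the power \<open>100 d\<close>, and 2 from
  \<open>3 \<le> exp 2\<close>. Since \<open>m / 4\<close> is at least \<open>100 d\<close>, the
  tail wins with room to spare.\<close>

lemma failure_probability_bound:
  assumes "real m \<ge> 400 * real d"
  shows "2 * (2 ^ (100 * d) * 3 ^ d) * exp (- (real m / 4)) \<le> 2 * exp (- real d)"
proof -
  have two: "(2 :: real) \<le> exp (9 / 10)"
  proof -
    have "(2 :: real) \<le> (1 + 3 / 10) ^ 3" by (simp add: power3_eq_cube)
    also have "\<dots> \<le> exp (3 / 10) ^ 3" by (intro power_mono exp_ge_add_one_self) auto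
    also have "\<dots> = exp (9 / 10)" by (simp flip: exp_of_nat_mult)
    finally show ?thesis .
  qed
  have three: "(3 :: real) \<le> exp 2" using exp_ge_add_one_self[of 2] by simp
  have "(2 :: real) ^ (100 * d) * 3 ^ d \<le> exp (9 / 10) ^ (100 * d) * exp 2 ^ d"
    using two three by (intro mult_mono power_mono) auto
  also have "\<dots> = exp (92 * real d)" by (simp flip: exp_of_nat_mult exp_add)
  finally have "(2 ^ (100 * d) * 3 ^ d) * exp (- (real m / 4)) \<le> exp (92 * real d) * exp (- (100 * real d))"
    using assms by (intro mult_mono) auto
  also have "\<dots> \<le> exp (- real d)" by (simp flip: exp_add)
  finally show ?thesis by simp
qed

theorem theorem7:
  fixes c :: real
  assumes "c > 0"
  shows "\<exists>C>0. \<exists>K>0. \<exists>d0::nat. \<forall>d\<ge>d0. \<forall>(n::nat) (m::nat) (\<epsilon>::real) (A::real mat)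
           (M::'w measure) (S::'w \<Rightarrow> real mat) (a::real vec) (b::real vec) (xs::real vec).
    0 < \<epsilon> \<longrightarrow> \<epsilon> < 1 \<longrightarrow>
    A \<in> carrier_mat n d \<longrightarrow> vec_space.rank n A = d \<longrightarrow>
    real m \<ge> C * real d / \<epsilon>\<^sup>2 \<longrightarrow>
    gaussian_sketch M m n S \<longrightarrow>
    a \<in> carrier_vec d \<longrightarrow> b \<in> carrier_vec n \<longrightarrow>
    xs = pinv A *\<^sub>v b \<longrightarrow>
    \<P>(\<omega> in M.
        \<bar>a \<bullet> (pinv (S \<omega> * A) *\<^sub>v (S \<omega> *\<^sub>v b)) - a \<bullet> xs\<bar>
          \<le> K * (\<epsilon> * sqrt (ln (real d)) / sqrt (real d)
                  * euclid_norm a * euclid_norm (b - A *\<^sub>v xs) * spectral_norm (pinv A)))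
      \<ge> 1 - real d powr (- c)"
proof -
  \<comment> \<open>The 5 is the distortion of the embedding, and the square root is the part of
    \<open>sqrt t\<close> that depends on \<open>c\<close>.\<close>
  define K where "K = 5 * sqrt (2 * (c + 1))"
  have K: "K > 0" using assms by (simp add: K_def)
  have "eventually (\<lambda>d::nat. 2 * exp (- real d) \<le> real d powr (- c) / 2) at_top"
    by real_asymp
  then obtain d1 where d1: "\<And>d. d \<ge> d1 \<Longrightarrow> 2 * exp (- real d) \<le> real d powr (- c) / 2"
    by (auto simp: eventually_at_top_linorder)
  show ?thesis
  \<comment> \<open>The factor 400 is dictated by the size of the net and does not depend on
    \<open>c\<close>. The threshold \<open>d1\<close> makes the embedding failure at most half of
    the allowed probability, and \<open>d \<ge> 4\<close> does the same for the Gaussian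
    tail.\<close>
  proof (rule exI[of _ 400], rule conjI, simp, rule exI[of _ K], rule conjI, rule K,
      rule exI[of _ "max d1 4"], intro allI impI)
    fix d n m :: nat and \<epsilon> :: real and A :: "real mat" and M :: "'w measure" and S :: "'w \<Rightarrow> real mat"
      and a b xs :: "real vec"
    assume d: "max d1 4 \<le> d" and \<epsilon>: "0 < \<epsilon>" "\<epsilon> < 1"
      and A: "A \<in> carrier_mat n d" and rank: "vec_space.rank n A = d"
      and m: "real m \<ge> 400 * real d / \<epsilon>\<^sup>2" and sketch: "gaussian_sketch M m n S"
      and a: "a \<in> carrier_vec d" and b: "b \<in> carrier_vec n" and xs: "xs = pinv A *\<^sub>v b"
    let ?Q = "gauss_matrix m n (sqrt (1 / real m))"
    define R where "R = euclid_norm a * euclid_norm (b - A *\<^sub>v xs) * spectral_norm (pinv A)"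
    define \<tau> where "\<tau> = K * (\<epsilon> * sqrt (ln (real d)) / sqrt (real d)
                  * euclid_norm a * euclid_norm (b - A *\<^sub>v xs) * spectral_norm (pinv A))"
    \<comment> \<open>With this \<open>t\<close> the tail is \<open>2 * d powr (- c - 1)\<close>;
      the extra factor \<open>1 / d\<close> absorbs the constant once
      \<open>d \<ge> 4\<close>.\<close>
    define t where "t = 2 * (c + 1) * ln (real d)"
    note injA = full_rank_imp_inj[OF A rank]
    have d4: "real d \<ge> 4" using d by simp
    have d_pos: "d > 0" using d by simp
    \<comment> \<open>The product representation of the law needs a nonempty index set; with no rows
      every unit vector would lie in the kernel of \<open>A\<close>.\<close>
    have n_pos: "n > 0"
    proof (rule ccontr)
      assume "\<not> n > 0"
      then have "A *\<^sub>v unit_vec d 0 = 0\<^sub>v n" using A by (intro eq_vecI) auto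
      then have "unit_vec d 0 = (0\<^sub>v d :: real vec)" using injA by simp
      then have "unit_vec d 0 $ 0 = (0\<^sub>v d $ 0 :: real)" by simp
      then show False using d_pos by simp
    qed
    have "\<epsilon>\<^sup>2 \<le> 1" using \<epsilon> by (simp add: power_le_one)
    then have "400 * real d \<le> 400 * real d / \<epsilon>\<^sup>2" using \<epsilon> by (simp add: pos_le_divide_eq mult_left_le)
    then have m400: "real m \<ge> 400 * real d" using m by linarith
    then have m_pos: "m > 0" using d4 by (cases m) auto
    have ln_pos: "ln (real d) > 0" using d4 by simp
    have t: "t > 0" using assms ln_pos by (simp add: t_def)
    have "sqrt (t / real m) * (5 * euclid_norm a * spectral_norm (pinv A) * euclid_norm (b - A *\<^sub>v xs)) \<le> \<tau>"
    proof -
      \<comment> \<open>For the error scale it is enough that \<open>m\<close> is at least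
        \<open>d / \<epsilon>^2\<close>; the factor 400 is spent on the embedding.\<close>
      have "real d / \<epsilon>\<^sup>2 \<le> 400 * real d / \<epsilon>\<^sup>2" by (intro divide_right_mono) auto
      then have "real d \<le> real m * \<epsilon>\<^sup>2" using m \<epsilon> by (simp add: pos_divide_le_eq)
      then have "1 / real m \<le> \<epsilon>\<^sup>2 / real d" using m_pos d_pos by (simp add: field_simps)
      then have "t * (1 / real m) \<le> t * (\<epsilon>\<^sup>2 / real d)" using t by (intro mult_left_mono) auto
      then have "sqrt (t / real m) \<le> sqrt (t * \<epsilon>\<^sup>2 / real d)" by simp
      also have "\<dots> = sqrt (2 * (c + 1)) * (\<epsilon> * sqrt (ln (real d)) / sqrt (real d))"
        using \<epsilon> by (simp add: t_def real_sqrt_mult real_sqrt_divide)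
      finally have "sqrt (t / real m) * (5 * R) \<le> sqrt (2 * (c + 1)) * (\<epsilon> * sqrt (ln (real d)) / sqrt (real d)) * (5 * R)"
        using spectral_norm_nonneg by (intro mult_right_mono) (auto simp: R_def)
      then show ?thesis by (simp add: \<tau>_def K_def R_def mult_ac)
    qed
    note bound = gauss_sketch_error_prob[OF d_pos m_pos t A injA a b this[unfolded xs], folded xs]
    define E where "E = {x \<in> space ?Q. \<bar>a \<bullet> (pinv (mat m n x * A) *\<^sub>v (mat m n x *\<^sub>v b)) - a \<bullet> xs\<bar> \<le> \<tau>}"
    define X where "X \<omega> = (\<lambda>p\<in>{..<m} \<times> {..<n}. S \<omega> $$ p)" for \<omega>
    note X = gaussian_sketch_distr[OF sketch m_pos n_pos, folded X_def]
    \<comment> \<open>The event is the preimage of a measurable set of canonical matrices, so its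
      probability is computed under \<open>gauss_matrix\<close>.\<close>
    have "{\<omega> \<in> space M. \<bar>a \<bullet> (pinv (S \<omega> * A) *\<^sub>v (S \<omega> *\<^sub>v b)) - a \<bullet> xs\<bar> \<le> \<tau>} = X -` E \<inter> space M"
      using X(3) measurable_space[OF X(1)] by (auto simp: E_def)
    then have "\<P>(\<omega> in M. \<bar>a \<bullet> (pinv (S \<omega> * A) *\<^sub>v (S \<omega> *\<^sub>v b)) - a \<bullet> xs\<bar> \<le> \<tau>) = measure M (X -` E \<inter> space M)"
      by simp
    also have "\<dots> = measure (distr M ?Q X) E"
      using X(1) bound(1) by (intro measure_distr[symmetric]) (auto simp: E_def)
    also have "\<dots> = measure ?Q E" by (simp only: X(2))
    finally have eq: "\<P>(\<omega> in M. \<bar>a \<bullet> (pinv (S \<omega> * A) *\<^sub>v (S \<omega> *\<^sub>v b)) - a \<bullet> xs\<bar> \<le> \<tau>) = measure ?Q E" .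
    have "measure ?Q E \<ge> 1 - (2 * (2 ^ (100 * d) * 3 ^ d) * exp (- (real m / 4)) + 2 * exp (- t / 2))"
      unfolding E_def by (rule bound(2))
    moreover have "2 * (2 ^ (100 * d) * 3 ^ d) * exp (- (real m / 4)) \<le> real d powr (- c) / 2"
      using failure_probability_bound[OF m400] d1[of d] d by simp
    moreover have "2 * exp (- t / 2) \<le> real d powr (- c) / 2"
    proof -
      have "- t / 2 = (- c + - 1) * ln (real d)" by (simp add: t_def field_simps)
      then have "exp (- t / 2) = real d powr (- c + - 1)" using d_pos by (simp only: powr_def) simp
      also have "\<dots> = real d powr (- c) * real d powr (- 1)" by (rule powr_add)
      also have "\<dots> = real d powr (- c) / real d" using d_pos by (simp add: powr_minus_divide)
      also have "\<dots> \<le> real d powr (- c) / 4" using d4 by (intro divide_left_mono) auto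
      finally show ?thesis by simp
    qed
    ultimately show "\<P>(\<omega> in M.
        \<bar>a \<bullet> (pinv (S \<omega> * A) *\<^sub>v (S \<omega> *\<^sub>v b)) - a \<bullet> xs\<bar>
          \<le> K * (\<epsilon> * sqrt (ln (real d)) / sqrt (real d)
                  * euclid_norm a * euclid_norm (b - A *\<^sub>v xs) * spectral_norm (pinv A)))
      \<ge> 1 - real d powr (- c)"
      unfolding \<tau>_def[symmetric] eq by linarith
  qed
qed

end
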